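(* Let $1\le m\le q/p^b$ and let $\mathbf{P}_{m+1}=(P_\infty,P_1,\ldots,P_m)$ on the curve $\mathcal{X}_{a,b,n,s}$. For $(i,j)\in\mathcal{I}$ let $$\alpha^{i,j,m}:=\left(\tfrac{1}{p^b}\left[(q^2-mp^b)(q+1)M-iqM-jq^3\right],\,iM+j,\ldots,iM+j\right)\in\mathbb{Z}^{m+1},$$ and let $\widehat{S}_{m+1}=\{\alpha^{i,j,m} : (i,j)\in\mathcal{I}\}$. Then $$\widehat{\Gamma}(\mathbf{P}_{m+1})\cap\mathcal{C}_{m+1}=\widehat{S}_{m+1}\cup\{\mathbf{0}\}.$$
   Context: Let $p$ be a prime, $a\ge 1$, $q=p^a$, and let $n,b,s\ge 1$ be integers with $n$ odd, $b\mid a$, and $s\mid\frac{q^n+1}{q+1}$. Put $M=\frac{q^n+1}{s(q+1)}$ and fix $c\in\mathbb{F}_{q^2}$ with $c^{q-1}=-1$. $\mathcal{X}_{a,b,n,s}$ is the nonsingular projective geometrically irreducible curve over $\mathbb{F}_{q^{2n}}$ given by the affine equations $c\,y^{q+1}=t(x):=\sum_{i=0}^{a/b-1}x^{p^{ib}}$ and $y^{q^2}-y=z^M$. $P_\infty$ is the unique common pole of $x,y,z$; $\alpha_1,\ldots,\alpha_{q/p^b}$ are the distinct roots of $t$, and $P_i$ is the rational point $(x,y,z)=(\alpha_i,0,0)$, $1\le i\le q/p^b$. $\mathcal{I}:=\{(i,j)\in\mathbb{Z}^2: 0\le i\le q,\ 1\le j\le M\}\setminus\{(q,M)\}$. Generalized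 Weierstrass semigroup: for an $r$-tuple $\mathbf{Q}=(Q_1,\ldots,Q_r)$ of distinct rational points on a curve, $\widehat{H}(\mathbf{Q})=\{(-v_{Q_1}(h),\ldots,-v_{Q_r}(h)) : h\ne 0 \text{ a rational function regular outside } \{Q_1,\ldots,Q_r\}\}\subseteq\mathbb{Z}^r$, where $v_Q$ is the discrete valuation at $Q$. For $\alpha\in\mathbb{Z}^r$ and nonempty $J\subsetneq\{1,\ldots,r\}$, $\nabla_J(\alpha):=\{\beta\in\widehat{H}(\mathbf{Q}):\beta_j=\alpha_j\ (j\in J),\ \beta_i<\alpha_i\ (i\notin J)\}$. An element $\alpha\in\widehat{H}(\mathbf{Q})$ is absolute maximal if $\nabla_J(\alpha)=\emptyset$ for every nonempty $J\subsetneq\{1,\ldots,r\}$. $\widehat{\Gamma}(\mathbf{Q})$ is the set of absolute maximal elements of $\widehat{H}(\mathbf{Q})$. $\mathcal{C}_{m+1}:=\{\beta\in\mathbb{Z}^{m+1}: 0\le\beta_i<(q+1)M \text{ for } i=2,\ldots,m+1\}$. *)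

theory Defs
  imports "HOL-Computational_Algebra.Computational_Algebra"
begin

text \<open>
  The nonsingular projective curve is represented by its function field: a field type
  \<open>'f\<close> with a distinguished constant field \<open>K :: 'f set\<close>. Points are places
  of the function field, given by their normalised discrete valuations.
\<close>

definition is_subfield :: "'f::field set \<Rightarrow> bool" where
  "is_subfield K \<longleftrightarrow>
     0 \<in> K \<and> 1 \<in> K \<and>
     (\<forall>u\<in>K. \<forall>w\<in>K. u + w \<in> K \<and> u * w \<in> K) \<and>
     (\<forall>u\<in>K. - u \<in> K \<and> inverse u \<in> K)"

definition algebraic_over :: "'f::field set \<Rightarrow> 'f \<Rightarrow> bool" where
  "algebraic_over K u \<longleftrightarrow>
     (\<exists>g :: 'f poly. g \<noteq> 0 \<and> (\<forall>i. coeff g i \<in> K) \<and> poly g u = 0)"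

definition tpoly :: "nat \<Rightarrow> nat \<Rightarrow> nat \<Rightarrow> 'f::field \<Rightarrow> 'f" where
  "tpoly p a b u = (\<Sum>i<a div b. u ^ (p ^ (i * b)))"

text \<open>
  The type \<open>'f\<close>, with constant field \<open>K\<close> of order \<open>q ^ (2 * n)\<close>, is the function
  field of the curve and \<open>x, y, z\<close> are its coordinate functions. Since \<open>K\<close> is perfect,
  geometric irreducibility says that \<open>K\<close> is algebraically closed in \<open>'f\<close>.
\<close>

definition curve_function_field ::
  "nat \<Rightarrow> nat \<Rightarrow> nat \<Rightarrow> nat \<Rightarrow> nat \<Rightarrow> 'f::field \<Rightarrow> 'f set \<Rightarrow> 'f \<Rightarrow> 'f \<Rightarrow> 'f \<Rightarrow> bool" where
  "curve_function_field p a b n s c K x y z \<longleftrightarrow>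
     (let q = p ^ a; M = (q ^ n + 1) div (s * (q + 1)) in
        is_subfield K \<and> card K = q ^ (2 * n) \<and>
        (\<forall>L. is_subfield L \<and> K \<subseteq> L \<and> {x, y, z} \<subseteq> L \<longrightarrow> L = UNIV) \<and>
        \<not> algebraic_over K x \<and>
        (\<forall>u. algebraic_over K u \<longrightarrow> u \<in> K) \<and>
        c * y ^ (q + 1) = tpoly p a b x \<and>
        y ^ (q ^ 2) - y = z ^ M)"

text \<open>
  The value \<open>v 0 = 0\<close> is a mere convention: it makes a valuation determined by its
  values on nonzero functions, so that different \<open>v\<close> are different places.
\<close>

definition is_place :: "'f::field set \<Rightarrow> ('f \<Rightarrow> int) \<Rightarrow> bool" where
  "is_place K v \<longleftrightarrow>
     v 0 = 0 \<and>
     (\<forall>f g. f \<noteq> 0 \<and> g \<noteq> 0 \<longrightarrow> v (f * g) = v f + v g) \<and>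
     (\<forall>f g. f \<noteq> 0 \<and> g \<noteq> 0 \<and> f + g \<noteq> 0 \<longrightarrow> min (v f) (v g) \<le> v (f + g)) \<and>
     (\<forall>u\<in>K. v u = 0) \<and>
     (\<exists>f. f \<noteq> 0 \<and> v f = 1)"

definition vanishes_at :: "('f::field \<Rightarrow> int) \<Rightarrow> 'f \<Rightarrow> bool" where
  "vanishes_at v f \<longleftrightarrow> f = 0 \<or> 0 < v f"

definition regular_at :: "('f::field \<Rightarrow> int) \<Rightarrow> 'f \<Rightarrow> bool" where
  "regular_at v f \<longleftrightarrow> f = 0 \<or> 0 \<le> v f"

text \<open>Rational means of degree one: the residue field is \<open>K\<close>.\<close>

definition rational_place :: "'f::field set \<Rightarrow> ('f \<Rightarrow> int) \<Rightarrow> bool" where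
  "rational_place K v \<longleftrightarrow>
     is_place K v \<and> (\<forall>f. regular_at v f \<longrightarrow> (\<exists>u\<in>K. vanishes_at v (f - u)))"

text \<open>Tuples in \<open>\<int>\<^sup>r\<close> are integer lists of length \<open>r\<close>, indexed from \<open>0\<close>.\<close>

definition gen_weierstrass_semigroup ::
  "'f::field set \<Rightarrow> ('f \<Rightarrow> int) list \<Rightarrow> int list set" where
  "gen_weierstrass_semigroup K Qs =
     {map (\<lambda>v. - v h) Qs | h.
        h \<noteq> 0 \<and> (\<forall>w. is_place K w \<and> w \<notin> set Qs \<longrightarrow> regular_at w h)}"

definition nabla ::
  "'f::field set \<Rightarrow> ('f \<Rightarrow> int) list \<Rightarrow> nat set \<Rightarrow> int list \<Rightarrow> int list set" where
  "nabla K Qs J \<alpha> =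
     {\<beta> \<in> gen_weierstrass_semigroup K Qs.
        (\<forall>j\<in>J. \<beta> ! j = \<alpha> ! j) \<and> (\<forall>i\<in>{..<length Qs} - J. \<beta> ! i < \<alpha> ! i)}"

definition absolute_maximal_elements ::
  "'f::field set \<Rightarrow> ('f \<Rightarrow> int) list \<Rightarrow> int list set" where
  "absolute_maximal_elements K Qs =
     {\<alpha> \<in> gen_weierstrass_semigroup K Qs.
        \<forall>J. J \<noteq> {} \<and> J \<subset> {..<length Qs} \<longrightarrow> nabla K Qs J \<alpha> = {}}"

text \<open>The first coordinate, at index \<open>0\<close>, is unconstrained.\<close>

definition fundamental_box :: "nat \<Rightarrow> nat \<Rightarrow> nat \<Rightarrow> int list set" where
  "fundamental_box q M m =
     {\<beta>. length \<beta> = m + 1 \<and> (\<forall>i\<in>{1..m}. 0 \<le> \<beta> ! i \<and> \<beta> ! i < (int q + 1) * int M)}"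

definition index_set :: "nat \<Rightarrow> nat \<Rightarrow> (int \<times> int) set" where
  "index_set q M = {0..int q} \<times> {1..int M} - {(int q, int M)}"

text \<open>The division is exact, since \<open>p ^ b\<close> divides \<open>q\<close>.\<close>

definition alpha_tuple ::
  "nat \<Rightarrow> nat \<Rightarrow> nat \<Rightarrow> nat \<Rightarrow> nat \<Rightarrow> int \<Rightarrow> int \<Rightarrow> int list" where
  "alpha_tuple p b q M m i j =
     (((int q ^ 2 - int m * int p ^ b) * (int q + 1) * int M
        - i * int q * int M - j * int q ^ 3) div (int p ^ b))
     # replicate m (i * int M + j)"

definition S_hat :: "nat \<Rightarrow> nat \<Rightarrow> nat \<Rightarrow> nat \<Rightarrow> nat \<Rightarrow> int list set" where
  "S_hat p b q M m = {alpha_tuple p b q M m i j | i j. (i, j) \<in> index_set q M}"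

end

theory Submission
  imports Defs "HOL-Number_Theory.Cong"
begin

text \<open>
  Write \<open>r = q / p\<^sup>b\<close> for the degree of \<open>t\<close> and \<open>A = K[x, y, z]\<close> for the affine coordinate ring. The
  equations of the curve allow every element of \<open>A\<close> to be written as \<open>\<Sum> g\<^sub>d\<^sub>f(x) y\<^sup>d z\<^sup>f\<close> with
  \<open>0 \<le> d \<le> q\<close> and \<open>0 \<le> f < M\<close>. At \<open>P\<^sub>\<infinity>\<close> the functions \<open>x, y, z\<close> have the pole orders
  \<open>(q + 1) M\<close>, \<open>r M\<close>, \<open>r q\<^sup>2\<close>, and at \<open>P\<^sub>k\<close> the functions \<open>x - \<alpha>\<^sub>k, y, z\<close> have the orders
  \<open>(q + 1) M\<close>, \<open>M\<close>, \<open>1\<close>. Because \<open>q + 1\<close> and \<open>M\<close> are prime to \<open>p\<close>, the exponents \<open>(d, f)\<close> of a term can be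
  recovered from its order modulo \<open>(q + 1) M\<close>, at each of these points. So the terms of a normal form
  never cancel there, and the order of a function is the least order of its terms
  (\<open>order_of_normal_form\<close>). The same computation shows that a place is determined by lying over
  \<open>x = \<infinity>\<close> or over \<open>x = \<alpha>\<^sub>k\<close> (\<open>graded_unique\<close>).

  To apply this to the semigroup one has to know that \<open>A\<close> contains every function whose poles all lie at
  \<open>P\<^sub>\<infinity>\<close> (\<open>regular_away_from_inf_in_A\<close>), which holds because the affine curve is smooth. The proof
  constructs, for every function outside \<open>A\<close>, an affine place where it has a pole
  (\<open>place_of_pole_exists\<close>). Since \<open>K\<close> is finite, so is \<open>A\<close> modulo any nonzero element, and hence every
  nonzero prime ideal contains some \<open>\<theta> = z\<^bsup>p\<^sup>k\<^esup> - z\<close>. The equations express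
  \<open>y\<close> through \<open>z\<close> and \<open>p\<close>-th powers, and \<open>x\<close> through \<open>y\<close> and \<open>p\<close>-th powers, which makes the Frobenius
  map of \<open>A / \<theta> A\<close> a permutation of finite order (\<open>A_frobenius_periodic\<close>). Therefore \<open>A / \<theta> A\<close> is reduced and \<open>\<theta>\<close> is a local parameter.

  Multiplying by powers of the \<open>x - \<alpha>\<^sub>k\<close>, every function with poles only at the chosen points decomposes
  into components \<open>g(x) y\<^sup>d z\<^sup>f\<close> with \<open>g\<close> a rational function (\<open>extremal_component\<close>). Such a component matters
  only through \<open>d\<close>, \<open>f\<close>, the orders of \<open>g\<close> at the \<open>\<alpha>\<^sub>k\<close> and its degree, which is at least the sum of these
  orders. It follows that the absolute maximal elements are exactly the pole orders of the monomials
  \<open>(\<Prod>k. (x - \<alpha>\<^sub>k)\<^bsup>e k\<^esup>) y\<^sup>d z\<^sup>f\<close> (\<open>monomial_absolute_maximal\<close>, \<open>absolute_maximal_monomial\<close>). In the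
  box all \<open>e k\<close> are \<open>-1\<close>, or all are \<open>0\<close> and \<open>d = f = 0\<close>, which is the theorem.
\<close>

section \<open>Discrete valuations\<close>

text \<open>
  By convention \<open>v 0 = 0\<close>, although the zero function vanishes to every order; this relation
  treats it correctly and is therefore stable under sums.
\<close>

definition ord_ge :: "('f::field \<Rightarrow> int) \<Rightarrow> int \<Rightarrow> 'f \<Rightarrow> bool" where
  "ord_ge v k f \<longleftrightarrow> f = 0 \<or> k \<le> v f"

locale place_over =
  fixes K :: "'f::field set" and v :: "'f \<Rightarrow> int"
  assumes subfield: "is_subfield K" and place: "is_place K v"
begin

lemma val_mult: "f \<noteq> 0 \<Longrightarrow> g \<noteq> 0 \<Longrightarrow> v (f * g) = v f + v g"
  using place by (simp add: is_place_def)

lemma val_const: "u \<in> K \<Longrightarrow> v u = 0"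
  using place by (simp add: is_place_def)

lemma val_0: "v 0 = 0"
  using place by (simp add: is_place_def)

lemma val_1: "v 1 = 0"
  using subfield by (auto simp: is_subfield_def intro: val_const)

lemma val_minus: "v (- f) = v f"
proof (cases "f = 0")
  case False
  have "-1 \<in> K" using subfield by (auto simp: is_subfield_def)
  then have "v ((-1) * f) = v f" using False val_mult[of "-1" f] val_const by simp
  then show ?thesis by simp
qed simp

lemma val_power: "f \<noteq> 0 \<Longrightarrow> v (f ^ n) = int n * v f"
  by (induction n) (simp_all add: val_1 val_mult algebra_simps)

lemma val_inverse: "v (inverse f) = - v f"
proof (cases "f = 0")
  case False
  then have "v (f * inverse f) = v f + v (inverse f)" by (intro val_mult) auto
  with False show ?thesis by (simp add: val_1)
qed (simp add: val_0)

lemma val_divide: "f \<noteq> 0 \<Longrightarrow> g \<noteq> 0 \<Longrightarrow> v (f / g) = v f - v g"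
  by (simp add: divide_inverse val_mult val_inverse)

lemma val_power_int: "f \<noteq> 0 \<Longrightarrow> v (f powi k) = k * v f"
  by (cases k rule: int_cases2) (simp_all add: val_power power_int_minus val_inverse)

lemma val_prod:
  assumes "finite I" "\<And>i. i \<in> I \<Longrightarrow> f i \<noteq> 0"
  shows "v (prod f I) = (\<Sum>i\<in>I. v (f i))"
  using assms by (induction I) (simp_all add: val_1 val_mult)

lemma ord_ge_add: "ord_ge v k f \<Longrightarrow> ord_ge v k g \<Longrightarrow> ord_ge v k (f + g)"
proof (cases "f = 0 \<or> g = 0 \<or> f + g = 0")
  case False
  then have "min (v f) (v g) \<le> v (f + g)" using place by (simp add: is_place_def)
  moreover assume "ord_ge v k f" "ord_ge v k g"
  ultimately show ?thesis using False by (auto simp: ord_ge_def)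
qed (auto simp: ord_ge_def)

lemma ord_ge_minus: "ord_ge v k (- f) \<longleftrightarrow> ord_ge v k f"
  by (simp add: ord_ge_def val_minus)

lemma ord_ge_diff: "ord_ge v k f \<Longrightarrow> ord_ge v k g \<Longrightarrow> ord_ge v k (f - g)"
  using ord_ge_add[of k f "- g"] by (simp add: ord_ge_minus)

lemma ord_ge_mult: "ord_ge v k f \<Longrightarrow> ord_ge v l g \<Longrightarrow> ord_ge v (k + l) (f * g)"
  by (cases "f = 0"; cases "g = 0") (auto simp: ord_ge_def val_mult)

lemma ord_ge_sum: "(\<And>i. i \<in> I \<Longrightarrow> ord_ge v k (f i)) \<Longrightarrow> ord_ge v k (sum f I)"
  by (induction I rule: infinite_finite_induct) (simp_all add: ord_ge_add, simp_all add: ord_ge_def)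

lemma add_dominant:
  assumes "f \<noteq> 0" "ord_ge v (v f + 1) g"
  shows "f + g \<noteq> 0 \<and> v (f + g) = v f"
proof -
  have ne: "f + g \<noteq> 0"
  proof
    assume "f + g = 0"
    then have "g = - f" by (simp add: add_eq_0_iff2 minus_equation_iff)
    with assms show False by (simp add: ord_ge_def val_minus)
  qed
  have "ord_ge v (v f) f" by (simp add: ord_ge_def)
  moreover have "ord_ge v (v f) g" using assms(2) by (auto simp: ord_ge_def)
  ultimately have ge: "v f \<le> v (f + g)" using ord_ge_add[of "v f" f g] ne by (auto simp: ord_ge_def)
  have "\<not> v f < v (f + g)"
  proof
    assume "v f < v (f + g)"
    then have "ord_ge v (v f + 1) (f + g)" by (simp add: ord_ge_def)
    from ord_ge_diff[OF this assms(2)] assms(1) show False by (simp add: ord_ge_def)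
  qed
  with ne ge show ?thesis by simp
qed

text \<open>
  Terms of different orders cannot cancel: the one of least order dominates the sum of the
  others.
\<close>

lemma sum_distinct_orders:
  assumes "finite I" and ne: "\<exists>i\<in>I. t i \<noteq> 0"
    and distinct: "\<And>i j. i \<in> I \<Longrightarrow> j \<in> I \<Longrightarrow> t i \<noteq> 0 \<Longrightarrow> t j \<noteq> 0 \<Longrightarrow> v (t i) = v (t j) \<Longrightarrow> i = j"
  obtains i where "i \<in> I" "t i \<noteq> 0" "sum t I \<noteq> 0" "v (sum t I) = v (t i)"
    "\<And>j. j \<in> I \<Longrightarrow> t j \<noteq> 0 \<Longrightarrow> v (t i) \<le> v (t j)"
proof -
  let ?J = "{i \<in> I. t i \<noteq> 0}"
  have "finite ?J" "?J \<noteq> {}" using assms by auto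
  then have "finite ((\<lambda>i. v (t i)) ` ?J)" "(\<lambda>i. v (t i)) ` ?J \<noteq> {}" by auto
  from Min_in[OF this] obtain i where i: "i \<in> ?J" "Min ((\<lambda>i. v (t i)) ` ?J) = v (t i)" by auto
  have min: "v (t i) \<le> v (t j)" if "j \<in> I" "t j \<noteq> 0" for j
    using \<open>finite ?J\<close> that unfolding i(2)[symmetric] by (intro Min_le) auto
  have "ord_ge v (v (t i) + 1) (sum t (I - {i}))"
  proof (rule ord_ge_sum)
    fix j assume "j \<in> I - {i}"
    then show "ord_ge v (v (t i) + 1) (t j)"
      using min[of j] distinct[of i j] i(1) unfolding ord_ge_def by force
  qed
  from add_dominant[OF _ this] i(1) sum.remove[OF \<open>finite I\<close>, of i t] min show thesis
    by (intro that[of i]) auto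
qed

end

text \<open>
  Both valuations take the value 1, so the two factors of proportionality divide each other.
\<close>

lemma proportional_places_eq:
  fixes v w :: "'f::field \<Rightarrow> int"
  assumes "is_place K v" "is_place K w" "0 < l" "0 < k"
    and proportional: "\<And>f. f \<noteq> 0 \<Longrightarrow> k * v f = l * w f"
  shows "v = w"
proof -
  obtain f where "f \<noteq> 0" "v f = 1" using assms(1) by (auto simp: is_place_def)
  with proportional[of f] have "l dvd k" by simp
  obtain g where "g \<noteq> 0" "w g = 1" using assms(2) by (auto simp: is_place_def)
  with proportional[of g] have "k dvd l" by (metis dvd_triv_left mult.right_neutral)
  with \<open>l dvd k\<close> assms(3,4) have "k = l" by (simp add: zdvd_antisym_nonneg)
  show ?thesis
  proof
    fix f show "v f = w f"
      using proportional[of f] \<open>k = l\<close> assms(1-3) by (cases "f = 0") (auto simp: is_place_def)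
  qed
qed

section \<open>Polynomials over a subfield\<close>

definition polys_over :: "'f::field set \<Rightarrow> 'f poly set" where
  "polys_over K = {g. \<forall>i. coeff g i \<in> K}"

locale subfield =
  fixes K :: "'f::field set"
  assumes is_subfield: "is_subfield K"
begin

lemma K_closed:
  "0 \<in> K" "1 \<in> K" "u \<in> K \<Longrightarrow> w \<in> K \<Longrightarrow> u + w \<in> K" "u \<in> K \<Longrightarrow> w \<in> K \<Longrightarrow> u * w \<in> K"
  "u \<in> K \<Longrightarrow> - u \<in> K" "u \<in> K \<Longrightarrow> inverse u \<in> K"
  using is_subfield by (auto simp: is_subfield_def)

lemma K_diff: "u \<in> K \<Longrightarrow> w \<in> K \<Longrightarrow> u - w \<in> K"
  using K_closed(3)[of u "- w"] K_closed(5) by simp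

lemma K_power: "u \<in> K \<Longrightarrow> u ^ n \<in> K"
  by (induction n) (auto intro: K_closed)

lemma polys_pCons: "pCons u g \<in> polys_over K \<longleftrightarrow> u \<in> K \<and> g \<in> polys_over K"
proof
  assume "pCons u g \<in> polys_over K"
  then have "coeff (pCons u g) i \<in> K" for i by (simp add: polys_over_def)
  from this[of 0] this[of "Suc _"] show "u \<in> K \<and> g \<in> polys_over K"
    by (simp add: polys_over_def)
qed (auto simp: polys_over_def coeff_pCons split: nat.splits)

lemma polys_0: "0 \<in> polys_over K"
  by (simp add: polys_over_def K_closed)

lemma polys_1: "1 \<in> polys_over K"
  by (simp add: one_pCons polys_pCons polys_0 K_closed)

lemma polys_add: "g \<in> polys_over K \<Longrightarrow> h \<in> polys_over K \<Longrightarrow> g + h \<in> polys_over K"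
  by (simp add: polys_over_def K_closed)

lemma polys_smult: "u \<in> K \<Longrightarrow> h \<in> polys_over K \<Longrightarrow> smult u h \<in> polys_over K"
  by (simp add: polys_over_def K_closed)

lemma polys_mult: "g \<in> polys_over K \<Longrightarrow> h \<in> polys_over K \<Longrightarrow> g * h \<in> polys_over K"
proof (induction g)
  case (pCons u g)
  then show ?case by (simp add: polys_pCons polys_add polys_smult K_closed)
qed (simp add: polys_0)

lemma polys_monom: "u \<in> K \<Longrightarrow> monom u n \<in> polys_over K"
  by (simp add: polys_over_def K_closed)

lemma polys_sum: "(\<And>i. i \<in> I \<Longrightarrow> g i \<in> polys_over K) \<Longrightarrow> sum g I \<in> polys_over K"
  by (induction I rule: infinite_finite_induct) (auto intro: polys_0 polys_add)

lemma poly_in_K: "g \<in> polys_over K \<Longrightarrow> u \<in> K \<Longrightarrow> poly g u \<in> K"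
  by (induction g) (auto simp: polys_pCons K_closed)

lemma polys_synthetic_div:
  "g \<in> polys_over K \<Longrightarrow> u \<in> K \<Longrightarrow> synthetic_div g u \<in> polys_over K"
  by (induction g) (auto simp: polys_pCons polys_0 poly_in_K)

text \<open>
  Splitting off linear factors by synthetic division keeps all coefficients in \<open>K\<close>.
\<close>

lemma polys_order_decomp:
  assumes "g \<in> polys_over K" "g \<noteq> 0" "u \<in> K"
  obtains h where "h \<in> polys_over K" "g = [:- u, 1:] ^ order u g * h" "poly h u \<noteq> 0"
proof -
  have "\<exists>h. h \<in> polys_over K \<and> g = [:- u, 1:] ^ order u g * h \<and> poly h u \<noteq> 0"
    using assms
  proof (induction "degree g" arbitrary: g rule: less_induct)
    case less
    show ?case
    proof (cases "poly g u = 0")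
      case False
      then show ?thesis using less.prems by (intro exI[of _ g]) (auto simp: order_0I)
    next
      case True
      define k where "k = synthetic_div g u"
      have gk: "g = [:- u, 1:] * k" using synthetic_div_correct'[of u g] True by (simp add: k_def)
      have "k \<noteq> 0" using gk less.prems by auto
      have "degree g > 0"
      proof (rule ccontr)
        assume "\<not> degree g > 0"
        then obtain e where "g = [:e:]" using degree_eq_zeroE by blast
        with True less.prems(2) show False by simp
      qed
      then have "degree k < degree g" by (simp add: k_def degree_synthetic_div)
      from less.hyps[OF this _ \<open>k \<noteq> 0\<close> less.prems(3)] obtain h
        where h: "h \<in> polys_over K" "k = [:- u, 1:] ^ order u k * h" "poly h u \<noteq> 0"
        using polys_synthetic_div[OF less.prems(1,3)] k_def by blast
      have "order u g = order u [:- u, 1:] + order u k"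
        unfolding gk by (rule order_mult) (use gk less.prems in auto)
      also have "order u [:- u, 1:] = 1" using order_power_n_n[of u 1] by simp
      finally have "g = [:- u, 1:] ^ order u g * h"
        by (subst gk, subst h(2)) (simp only: power_add power_one_right mult.assoc)
      with h show ?thesis by blast
    qed
  qed
  with that show thesis by blast
qed

end

lemma dvd_diff_less_imp_eq:
  fixes m u w :: int
  assumes "m dvd u - w" "\<bar>u - w\<bar> < m"
  shows "u = w"
  using assms dvd_imp_le_int[of "u - w" m] by auto

section \<open>The coordinate ring of the affine curve\<close>

text \<open>
  Here \<open>r = q / p\<^sup>b\<close> is the degree of \<open>t\<close>. The integer \<open>M\<close> is prime to \<open>p\<close> since it divides
  \<open>q\<^sup>n + 1\<close>.
\<close>

locale affine_curve = subfield K
  for K :: "'f::field set" +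
  fixes p a b q r M :: nat and c x y z :: 'f
  assumes prime_p: "prime p" and a_pos: "a \<ge> 1" and b_pos: "b \<ge> 1" and b_dvd_a: "b dvd a"
    and q_def: "q = p ^ a" and r_def: "r = p ^ (a - b)"
    and M_pos: "M > 0" and coprime_M_p: "coprime M p"
    and finite_K: "finite K" and char_p: "CHAR('f) = p"
    and generated: "\<And>L. is_subfield L \<Longrightarrow> K \<subseteq> L \<Longrightarrow> {x, y, z} \<subseteq> L \<Longrightarrow> L = UNIV"
    and x_transcendental: "\<not> algebraic_over K x"
    and c_in_K: "c \<in> K" and c_nonzero: "c \<noteq> 0" and y_nonzero: "y \<noteq> 0" and z_nonzero: "z \<noteq> 0"
    and eq_xy: "c * y ^ (q + 1) = tpoly p a b x"
    and eq_yz: "y ^ (q ^ 2) - y = z ^ M"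
begin

lemma q_ge_2: "q \<ge> 2"
proof -
  have "p ^ 1 \<le> p ^ a"
    using prime_gt_0_nat[OF prime_p] a_pos by (intro power_increasing) auto
  then show ?thesis using prime_ge_2_nat[OF prime_p] by (simp add: q_def)
qed

lemma r_pos: "r > 0"
  using prime_gt_0_nat[OF prime_p] by (simp add: r_def)

lemma coprime_q1_r: "coprime (q + 1) r"
proof -
  have "coprime (q + 1) q" by simp
  then have "coprime (q + 1) p" using a_pos by (simp add: q_def)
  then show ?thesis by (simp add: r_def)
qed

lemma coprime_M_powers: "coprime M (r * q ^ 2)"
  using coprime_M_p by (simp add: r_def q_def)

lemma poly_x_nonzero: "g \<in> polys_over K \<Longrightarrow> g \<noteq> 0 \<Longrightarrow> poly g x \<noteq> 0"
  using x_transcendental by (auto simp: algebraic_over_def polys_over_def)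

lemma x_minus_const_nonzero: "u \<in> K \<Longrightarrow> x - u \<noteq> 0"
  using poly_x_nonzero[of "[:- u, 1:]"] by (simp add: polys_pCons polys_0 K_closed)

lemma a_div_b: "\<exists>k. a div b = Suc k \<and> k * b = a - b"
proof -
  obtain l where l: "a = b * l" using b_dvd_a by blast
  then obtain k where "l = Suc k" using a_pos by (cases l) auto
  then show ?thesis using l b_pos by (auto simp: algebra_simps)
qed

definition tau :: "'f poly" where
  "tau = (\<Sum>i<a div b. monom 1 (p ^ (i * b)))"

lemma tau_in_polys: "tau \<in> polys_over K"
  unfolding tau_def by (intro polys_sum polys_monom K_closed)

lemma poly_tau: "poly tau u = tpoly p a b u"
  by (simp add: tau_def tpoly_def poly_sum poly_monom)

text \<open>
  The monomials \<open>y\<^sup>d z\<^sup>f\<close> with these exponents form a basis of \<open>K[x, y, z]\<close> over \<open>K[x]\<close>, because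
  \<open>y\<^bsup>q+1\<^esup>\<close> and \<open>z\<^sup>M\<close> can be rewritten by the equations of the curve. The ring is given by this
  normal form, from which orders can be read off, so that its closure under multiplication has
  to be proved.
\<close>

definition exps :: "(nat \<times> nat) set" where
  "exps = {..q} \<times> {..<M}"

definition coord_ring :: "'f set" where
  "coord_ring = {\<Sum>(d, f)\<in>exps. poly (G d f) x * y ^ d * z ^ f | G. \<forall>d f. G d f \<in> polys_over K}"

abbreviation "A \<equiv> coord_ring"

lemma finite_exps: "finite exps"
  by (simp add: exps_def)

lemma A_add: assumes "f \<in> A" "g \<in> A" shows "f + g \<in> A"
proof -
  obtain F G where "\<forall>d e. F d e \<in> polys_over K" "f = (\<Sum>(d, e)\<in>exps. poly (F d e) x * y ^ d * z ^ e)"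
    "\<forall>d e. G d e \<in> polys_over K" "g = (\<Sum>(d, e)\<in>exps. poly (G d e) x * y ^ d * z ^ e)"
    using assms by (auto simp: coord_ring_def)
  then show ?thesis unfolding coord_ring_def
    by (intro CollectI exI[of _ "\<lambda>d e. F d e + G d e"])
       (auto simp: polys_add sum.distrib[symmetric] algebra_simps intro!: sum.cong)
qed

lemma A_0: "0 \<in> A"
  unfolding coord_ring_def by (intro CollectI exI[of _ "\<lambda>d e. 0"]) (auto simp: polys_0)

lemma A_sum: "(\<And>i. i \<in> I \<Longrightarrow> f i \<in> A) \<Longrightarrow> sum f I \<in> A"
  by (induction I rule: infinite_finite_induct) (auto intro: A_0 A_add)

lemma A_poly_mult: assumes "h \<in> polys_over K" "g \<in> A" shows "poly h x * g \<in> A"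
proof -
  obtain G where "\<forall>d e. G d e \<in> polys_over K" "g = (\<Sum>(d, e)\<in>exps. poly (G d e) x * y ^ d * z ^ e)"
    using assms by (auto simp: coord_ring_def)
  then show ?thesis unfolding coord_ring_def
    by (intro CollectI exI[of _ "\<lambda>d e. h * G d e"])
       (auto simp: polys_mult assms sum_distrib_left algebra_simps intro!: sum.cong)
qed

lemma A_basis: assumes "(d, f) \<in> exps" shows "y ^ d * z ^ f \<in> A"
proof -
  have "(\<Sum>(d', f')\<in>exps. poly (if (d', f') = (d, f) then 1 else 0) x * y ^ d' * z ^ f')
    = (\<Sum>i\<in>exps. if i = (d, f) then y ^ d * z ^ f else 0)"
    by (intro sum.cong) (auto split: if_splits)
  also have "\<dots> = y ^ d * z ^ f" using assms finite_exps by simp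
  finally show ?thesis unfolding coord_ring_def
    by (intro CollectI exI[of _ "\<lambda>d' f'. if (d', f') = (d, f) then 1 else 0"])
       (auto simp: polys_0 polys_1)
qed

text \<open>
  Multiplication is \<open>K[x]\<close>-linear, so stability of \<open>A\<close> may be tested on the basis.
\<close>

lemma A_mult_generator:
  assumes gen: "\<And>d f. (d, f) \<in> exps \<Longrightarrow> u * (y ^ d * z ^ f) \<in> A" and "g \<in> A"
  shows "u * g \<in> A"
proof -
  obtain G where G: "\<forall>d e. G d e \<in> polys_over K" "g = (\<Sum>(d, e)\<in>exps. poly (G d e) x * y ^ d * z ^ e)"
    using assms by (auto simp: coord_ring_def)
  have "u * g = (\<Sum>(d, e)\<in>exps. poly (G d e) x * (u * (y ^ d * z ^ e)))"
    unfolding G(2) by (auto simp: sum_distrib_left algebra_simps intro!: sum.cong)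
  also have "\<dots> \<in> A" using G(1) gen by (intro A_sum) (auto intro: A_poly_mult)
  finally show ?thesis .
qed

lemma A_mult_y: assumes "g \<in> A" shows "y * g \<in> A"
proof (rule A_mult_generator[OF _ assms])
  fix d f assume df: "(d, f) \<in> exps"
  show "y * (y ^ d * z ^ f) \<in> A"
  proof (cases "d < q")
    case True
    then show ?thesis using A_basis[of "Suc d" f] df by (simp add: exps_def mult.assoc)
  next
    case False
    then have "d = q" using df by (simp add: exps_def)
    have "y ^ (q + 1) = poly (smult (inverse c) tau) x"
      using c_nonzero by (simp add: poly_tau flip: eq_xy)
    then have "y * (y ^ d * z ^ f) = poly (smult (inverse c) tau) x * (y ^ 0 * z ^ f)"
      using \<open>d = q\<close> by (simp flip: mult.assoc)
    also have "\<dots> \<in> A"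
      using df by (intro A_poly_mult polys_smult tau_in_polys K_closed c_in_K A_basis) (auto simp: exps_def)
    finally show ?thesis .
  qed
qed

lemma A_mult_y_power: "g \<in> A \<Longrightarrow> y ^ d * g \<in> A"
  by (induction d) (auto simp: mult.assoc A_mult_y)

lemma A_diff: assumes "f \<in> A" "g \<in> A" shows "f - g \<in> A"
proof -
  have "poly [:-1:] x * g \<in> A" by (intro A_poly_mult assms) (auto simp: polys_pCons polys_0 K_closed)
  from A_add[OF assms(1) this] show ?thesis by simp
qed

lemma A_mult_z: assumes "g \<in> A" shows "z * g \<in> A"
proof (rule A_mult_generator[OF _ assms])
  fix d f assume df: "(d, f) \<in> exps"
  show "z * (y ^ d * z ^ f) \<in> A"
  proof (cases "Suc f < M")
    case True
    then show ?thesis using A_basis[of d "Suc f"] df by (simp add: exps_def mult_ac)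
  next
    case False
    then have "Suc f = M" using df by (simp add: exps_def)
    then have "z * (y ^ d * z ^ f) = y ^ d * (y ^ (q ^ 2) - y)"
      using eq_yz power_Suc[of z f] by (simp add: mult_ac)
    also have "\<dots> = y ^ (q ^ 2) * (y ^ d * z ^ 0) - y * (y ^ d * z ^ 0)" by (simp add: algebra_simps)
    also have "\<dots> \<in> A" using df by (intro A_diff A_mult_y_power A_mult_y A_basis) (auto simp: exps_def)
    finally show ?thesis .
  qed
qed

text \<open>
  Together with \<open>A_mult\<close> below this identifies \<open>A\<close> with the ring \<open>K[x, y, z]\<close>. It reduces closure
  under multiplication, regularity at affine places and periodicity of the Frobenius map to the
  generators.
\<close>

lemma A_induct:
  assumes K: "K \<subseteq> B" and xyz: "x \<in> B" "y \<in> B" "z \<in> B"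
    and add: "\<And>f g. f \<in> B \<Longrightarrow> g \<in> B \<Longrightarrow> f + g \<in> B"
    and mult: "\<And>f g. f \<in> B \<Longrightarrow> g \<in> B \<Longrightarrow> f * g \<in> B"
  shows "A \<subseteq> B"
proof
  fix g assume "g \<in> A"
  then obtain G where G: "\<forall>d e. G d e \<in> polys_over K" "g = (\<Sum>(d, e)\<in>exps. poly (G d e) x * y ^ d * z ^ e)"
    by (auto simp: coord_ring_def)
  have power: "u ^ k \<in> B" if "u \<in> B" for u and k :: nat
    using that K K_closed(2) by (induction k) (auto intro: mult)
  have "poly h x \<in> B" if "h \<in> polys_over K" for h
    using that
  proof (induction h)
    case 0 then show ?case using K K_closed(1) by auto
  next
    case (pCons u h) then show ?case using K xyz by (auto simp: polys_pCons intro!: add mult)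
  qed
  then have "poly (G d e) x * y ^ d * z ^ e \<in> B" for d e
    using G(1) by (intro mult power xyz) auto
  moreover have "sum f I \<in> B" if "\<And>i. i \<in> I \<Longrightarrow> f i \<in> B" for f and I :: "(nat \<times> nat) set"
    using that K K_closed(1) by (induction I rule: infinite_finite_induct) (auto intro!: add)
  ultimately show "g \<in> B" unfolding G(2) by fastforce
qed

lemma A_1: "1 \<in> A"
  using A_basis[of 0 0] M_pos by (simp add: exps_def)

lemma A_x_y_z: "x \<in> A" "y \<in> A" "z \<in> A"
  using A_poly_mult[of "[:0, 1:]", OF _ A_1] A_mult_y[OF A_1] A_mult_z[OF A_1]
  by (simp_all add: polys_pCons polys_0 K_closed)

lemma K_subset_A: "K \<subseteq> A"
proof
  fix u assume "u \<in> K"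
  then show "u \<in> A" using A_poly_mult[of "[:u:]", OF _ A_1] by (simp add: polys_pCons polys_0)
qed

lemma A_mult: assumes "f \<in> A" "g \<in> A" shows "f * g \<in> A"
proof -
  have "A \<subseteq> {u. \<forall>g\<in>A. u * g \<in> A}"
  proof (rule A_induct)
    show "K \<subseteq> {u. \<forall>g\<in>A. u * g \<in> A}"
    proof clarify
      fix u g assume "u \<in> K" "g \<in> A"
      then show "u * g \<in> A" using A_poly_mult[of "[:u:]" g] by (simp add: polys_pCons polys_0)
    qed
    show "x \<in> {u. \<forall>g\<in>A. u * g \<in> A}"
      using A_poly_mult[of "[:0, 1:]"] by (auto simp: polys_pCons polys_0 K_closed)
  qed (auto simp: A_mult_y A_mult_z A_add distrib_right mult.assoc)
  with assms(1) have "\<forall>g\<in>A. f * g \<in> A" by (rule subsetD[THEN CollectD, rotated])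
  with assms(2) show ?thesis by (rule bspec[rotated])
qed

lemma A_power: "f \<in> A \<Longrightarrow> f ^ n \<in> A"
  by (induction n) (auto intro: A_1 A_mult)

lemma A_minus: "f \<in> A \<Longrightarrow> - f \<in> A"
  using A_diff[OF A_0, of f] by simp

lemma fraction_of_A:
  obtains f g where "f \<in> A" "g \<in> A" "g \<noteq> 0" "h = f / g"
proof -
  let ?L = "{f / g | f g. f \<in> A \<and> g \<in> A \<and> g \<noteq> 0}"
  have in_L: "f \<in> ?L" if "f \<in> A" for f using that A_1 by (intro CollectI exI[of _ f] exI[of _ 1]) auto
  have "?L = UNIV"
  proof (rule generated)
    show "is_subfield ?L" unfolding is_subfield_def
    proof (intro conjI ballI)
      show "0 \<in> ?L" "1 \<in> ?L" by (rule in_L[OF A_0], rule in_L[OF A_1])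
      fix u assume "u \<in> ?L"
      then obtain f g where u: "f \<in> A" "g \<in> A" "g \<noteq> 0" "u = f / g" by blast
      show "- u \<in> ?L" using u by (intro CollectI exI[of _ "- f"] exI[of _ g]) (simp add: A_minus)
      show "inverse u \<in> ?L"
      proof (cases "f = 0")
        case True then show ?thesis using u \<open>0 \<in> ?L\<close> by (simp only: div_0 inverse_zero)
      next
        case False then show ?thesis using u by (intro CollectI exI[of _ g] exI[of _ f]) simp
      qed
      fix w assume "w \<in> ?L"
      then obtain f' g' where w: "f' \<in> A" "g' \<in> A" "g' \<noteq> 0" "w = f' / g'" by blast
      show "u + w \<in> ?L" using u w
        by (intro CollectI exI[of _ "f * g' + f' * g"] exI[of _ "g * g'"])
           (simp add: A_mult A_add add_frac_eq)
      show "u * w \<in> ?L" using u w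
        by (intro CollectI exI[of _ "f * f'"] exI[of _ "g * g'"]) (simp add: A_mult)
    qed
  qed (use in_L K_subset_A A_x_y_z in auto)
  then have "h \<in> ?L" by simp
  with that show thesis by blast
qed

section \<open>Orders of the coordinate functions\<close>

text \<open>
  The equations of the curve make \<open>y\<close> integral over \<open>K[x]\<close> and \<open>z\<close> integral over \<open>K[y]\<close>.
\<close>

lemma affine_place_nonneg:
  assumes "is_place K w" "0 \<le> w x" "f \<in> A"
  shows "ord_ge w 0 f"
proof -
  interpret place_over K w by unfold_locales (use is_subfield assms in auto)
  have poly: "ord_ge w 0 (poly g x)" if "g \<in> polys_over K" for g
    using that
  proof (induction g)
    case (pCons u g)
    then have "u \<in> K" "g \<in> polys_over K" by (auto simp: polys_pCons)
    then have "ord_ge w 0 u" "ord_ge w 0 x" "ord_ge w 0 (poly g x)"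
      using assms pCons.IH by (simp_all add: ord_ge_def val_const)
    then have "ord_ge w 0 u" "ord_ge w 0 (x * poly g x)" using ord_ge_mult[of 0 x 0 "poly g x"] by simp_all
    then show ?case by (simp add: ord_ge_add)
  qed (simp add: ord_ge_def)
  have "c * y ^ (q + 1) = poly tau x" using eq_xy poly_tau by simp
  then have "ord_ge w 0 (c * y ^ (q + 1))" using poly[OF tau_in_polys] by simp
  then have "0 \<le> int (q + 1) * w y"
    using c_nonzero c_in_K y_nonzero by (simp add: ord_ge_def val_mult val_power val_const distrib_right)
  then have y: "0 \<le> w y" by (simp add: zero_le_mult_iff)
  then have "ord_ge w 0 (y ^ (q ^ 2) - y)" using y_nonzero by (intro ord_ge_diff) (simp_all add: ord_ge_def val_power)
  then have "0 \<le> int M * w z" using z_nonzero by (simp add: eq_yz ord_ge_def val_power)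
  then have z: "0 \<le> w z" using M_pos by (simp add: zero_le_mult_iff)
  have "A \<subseteq> {f. ord_ge w 0 f}"
  proof (rule A_induct)
    fix f g assume "f \<in> {f. ord_ge w 0 f}" "g \<in> {f. ord_ge w 0 f}"
    then show "f + g \<in> {f. ord_ge w 0 f}" "f * g \<in> {f. ord_ge w 0 f}"
      using ord_ge_add ord_ge_mult[of 0 f 0 g] by auto
  qed (use y z assms in \<open>auto simp: ord_ge_def val_const\<close>)
  with assms show ?thesis by blast
qed

text \<open>
  Comparing leading terms in the two equations gives \<open>(q + 1) w(y) = r w(x)\<close> and
  \<open>M w(z) = q\<^sup>2 w(y)\<close>. Since \<open>q + 1\<close> and \<open>M\<close> are prime to \<open>p\<close>, the three orders are determined
  up to a common factor.
\<close>

lemma orders_at_pole_of_x: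
  assumes "is_place K w" "w x < 0"
  obtains l where "0 < l" "w x = - l * (int (q + 1) * int M)" "w y = - l * (int r * int M)"
    "w z = - l * (int r * int q ^ 2)"
proof -
  interpret place_over K w by unfold_locales (use is_subfield assms in auto)
  have "x \<noteq> 0" using assms val_0 by auto
  obtain k where k: "a div b = Suc k" "k * b = a - b" using a_div_b by blast
  have "ord_ge w (w (x ^ r) + 1) (\<Sum>i<k. x ^ (p ^ (i * b)))"
  proof (rule ord_ge_sum)
    fix i assume "i \<in> {..<k}"
    then have "p ^ (i * b) < p ^ (k * b)"
      using prime_gt_1_nat[OF prime_p] b_pos by (intro power_strict_increasing) auto
    then have "int (p ^ (i * b)) < int r" unfolding k(2) r_def by (simp only: of_nat_less_iff)
    then have "int r * w x < int (p ^ (i * b)) * w x" using assms(2) by (intro mult_strict_right_mono_neg)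
    then show "ord_ge w (w (x ^ r) + 1) (x ^ (p ^ (i * b)))"
      using \<open>x \<noteq> 0\<close> by (simp add: ord_ge_def val_power)
  qed
  moreover have "tpoly p a b x = x ^ r + (\<Sum>i<k. x ^ (p ^ (i * b)))"
    by (simp add: tpoly_def k r_def)
  ultimately have "w (tpoly p a b x) = int r * w x"
    using add_dominant[of "x ^ r"] \<open>x \<noteq> 0\<close> by (simp add: val_power)
  then have xy: "int (q + 1) * w y = int r * w x"
    using c_nonzero c_in_K y_nonzero by (simp add: val_mult val_power val_const distrib_right flip: eq_xy)
  moreover have "int r * w x < 0" using assms(2) r_pos by (simp add: mult_pos_neg)
  ultimately have "int (q + 1) * w y < 0" by simp
  then have "w y < 0" by (simp only: mult_less_0_iff) auto
  have "1 < q ^ 2" using q_ge_2 by (intro one_less_power) auto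
  then have "int 1 < int (q ^ 2)" by (simp only: of_nat_less_iff)
  then have "int (q ^ 2) * w y < 1 * w y" using \<open>w y < 0\<close> by (intro mult_strict_right_mono_neg) auto
  then have "ord_ge w (w (y ^ (q ^ 2)) + 1) (- y)"
    using y_nonzero by (simp add: ord_ge_minus, simp add: ord_ge_def val_power)
  from add_dominant[OF _ this] have "w (z ^ M) = int (q ^ 2) * w y"
    using y_nonzero by (simp add: val_power flip: eq_yz)
  then have yz: "int M * w z = int (q ^ 2) * w y" using z_nonzero by (simp add: val_power)
  have "int (q + 1) dvd int r * w x" by (metis xy dvd_triv_left)
  moreover have "coprime (int (q + 1)) (int r)" using coprime_q1_r coprime_int_iff by blast
  ultimately have "int (q + 1) dvd w x" using coprime_dvd_mult_right_iff by blast
  then obtain e where e: "w x = int (q + 1) * e" by blast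
  with xy have y: "w y = int r * e" by simp
  have "int M dvd int (r * q ^ 2) * e" using yz y by (metis dvd_triv_left mult.assoc mult.commute of_nat_mult)
  moreover have "coprime (int M) (int (r * q ^ 2))" using coprime_M_powers coprime_int_iff by blast
  ultimately have "int M dvd e" using coprime_dvd_mult_right_iff by blast
  then obtain l where l: "e = int M * l" by blast
  have "int M * w z = int M * (int r * int q ^ 2 * l)" using yz y l by (simp add: mult_ac)
  then have z: "w z = int r * int q ^ 2 * l" using M_pos by simp
  have "l < 0"
  proof (rule ccontr)
    assume "\<not> l < 0"
    then have "0 \<le> w x" unfolding e l by (intro mult_nonneg_nonneg) auto
    with assms(2) show False by simp
  qed
  then show thesis using e y z l by (intro that[of "- l"]) (auto simp: mult_ac)
qed

text \<open>
  The polynomial \<open>t\<close> is additive, so \<open>t(x) = t(x - u)\<close>, which has the order of its linear term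
  \<open>x - u\<close>. In the same way \<open>y\<close> dominates \<open>y\<^bsup>q\<^sup>2\<^esup> - y\<close>.
\<close>

lemma orders_at_root_of_t:
  assumes "is_place K w" "0 < w (x - u)" "u \<in> K" "tpoly p a b u = 0"
  shows "w (x - u) = w z * (int (q + 1) * int M)" "w y = w z * int M" "0 < w z"
proof -
  interpret place_over K w by unfold_locales (use is_subfield assms in auto)
  have ne: "x - u \<noteq> 0" using x_minus_const_nonzero assms by blast
  have frob: "(x - u) ^ (p ^ k) = x ^ (p ^ k) - u ^ (p ^ k)" for k
  proof -
    have "(x - u + u) ^ (p ^ k) = (x - u) ^ (p ^ k) + u ^ (p ^ k)"
      using char_p prime_p by (intro freshmans_dream') auto
    then show ?thesis by simp
  qed
  obtain k where k: "a div b = Suc k" using a_div_b by blast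
  have "tpoly p a b x = tpoly p a b x - tpoly p a b u" using assms by simp
  also have "\<dots> = (\<Sum>i<Suc k. (x - u) ^ (p ^ (i * b)))"
    by (simp only: tpoly_def k sum_subtractf[symmetric] frob)
  also have "\<dots> = (x - u) + (\<Sum>i<k. (x - u) ^ (p ^ (Suc i * b)))"
    by (subst sum.lessThan_Suc_shift) simp
  finally have t: "tpoly p a b x = (x - u) + (\<Sum>i<k. (x - u) ^ (p ^ (Suc i * b)))" .
  have "ord_ge w (w (x - u) + 1) (\<Sum>i<k. (x - u) ^ (p ^ (Suc i * b)))"
  proof (rule ord_ge_sum)
    fix i
    have "p ^ 0 < p ^ (Suc i * b)"
      using prime_gt_1_nat[OF prime_p] b_pos by (intro power_strict_increasing) auto
    then have "int 1 < int (p ^ (Suc i * b))" by (simp only: power_0 of_nat_less_iff)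
    then have "1 * w (x - u) < int (p ^ (Suc i * b)) * w (x - u)"
      using assms(2) by (intro mult_strict_right_mono) auto
    then show "ord_ge w (w (x - u) + 1) ((x - u) ^ (p ^ (Suc i * b)))"
      unfolding ord_ge_def val_power[OF ne] by simp
  qed
  from add_dominant[OF ne this] have "w (tpoly p a b x) = w (x - u)" unfolding t by simp
  then have xy: "w (x - u) = int (q + 1) * w y"
    using c_nonzero c_in_K y_nonzero by (simp add: val_mult val_power val_const distrib_right flip: eq_xy)
  then have "w y > 0" using assms(2) by (simp add: zero_less_mult_iff)
  have "1 < q ^ 2" using q_ge_2 by (intro one_less_power) auto
  then have "int 1 < int (q ^ 2)" by (simp only: of_nat_less_iff)
  then have "1 * w y < int (q ^ 2) * w y" using \<open>w y > 0\<close> by (intro mult_strict_right_mono) auto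
  then have "ord_ge w (w (- y) + 1) (y ^ (q ^ 2))"
    using y_nonzero by (simp add: ord_ge_def val_power val_minus)
  from add_dominant[OF _ this] have "w (z ^ M) = w y"
    using y_nonzero by (simp add: val_minus flip: eq_yz)
  then show y: "w y = w z * int M" using z_nonzero by (simp add: val_power mult.commute)
  then show "w (x - u) = w z * (int (q + 1) * int M)" using xy by simp
  show "0 < w z" using y \<open>w y > 0\<close> M_pos by (simp add: zero_less_mult_iff)
qed

text \<open>
  The orders of a term \<open>g(x) y\<^sup>d z\<^sup>f\<close> at the pole of \<open>x\<close> and at the zero
  \<open>(u, 0, 0)\<close> of \<open>x - u\<close>, where \<open>u\<close> is a root of \<open>t\<close>.
\<close>

definition term_order_inf :: "'f poly \<Rightarrow> nat \<Rightarrow> nat \<Rightarrow> int" where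
  "term_order_inf g d f =
     - (int (q + 1) * int M * int (degree g) + int d * (int r * int M) + int f * (int r * int q ^ 2))"

definition term_order_at :: "'f \<Rightarrow> 'f poly \<Rightarrow> nat \<Rightarrow> nat \<Rightarrow> int" where
  "term_order_at u g d f = int (q + 1) * int M * int (order u g) + int d * int M + int f"

text \<open>
  With respect to a weight function of this kind, the terms of a normal form all have different
  orders.
\<close>

definition separating :: "('f poly \<Rightarrow> nat \<Rightarrow> nat \<Rightarrow> int) \<Rightarrow> bool" where
  "separating W \<longleftrightarrow> (\<forall>g g' d f d' f'. (d, f) \<in> exps \<longrightarrow> (d', f') \<in> exps \<longrightarrow>
     W g d f = W g' d' f' \<longrightarrow> (d, f) = (d', f'))"

text \<open>
  Modulo \<open>M\<close> only the multiple of \<open>f\<close> survives, and it determines \<open>f < M\<close>; dividing by \<open>M\<close> and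
  reducing modulo \<open>q + 1\<close> then determines \<open>d \<le> q\<close>.
\<close>

lemma inf_residues_distinct:
  assumes "(d, f) \<in> exps" "(d', f') \<in> exps"
    and eq: "int (q + 1) * int M * e + int d * (int r * int M) + int f * (int r * int q ^ 2)
      = int (q + 1) * int M * e' + int d' * (int r * int M) + int f' * (int r * int q ^ 2)"
  shows "d = d' \<and> f = f'"
proof -
  have "int (r * q ^ 2) * (int f - int f')
    = int M * (int (q + 1) * (e' - e) + int r * (int d' - int d))"
    using eq by (simp add: algebra_simps)
  then have "int M dvd int (r * q ^ 2) * (int f - int f')" by simp
  moreover have "coprime (int M) (int (r * q ^ 2))" using coprime_M_powers coprime_int_iff by blast
  ultimately have "int M dvd int f - int f'" using coprime_dvd_mult_right_iff by blast
  moreover have "\<bar>int f - int f'\<bar> < int M" using assms(1,2) by (auto simp: exps_def)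
  ultimately have "int f = int f'" by (rule dvd_diff_less_imp_eq)
  then have f: "f = f'" by simp
  have "int M * (int (q + 1) * (e' - e)) = int M * (int r * (int d - int d'))"
    using eq f by (simp add: algebra_simps)
  then have "int (q + 1) * (e' - e) = int r * (int d - int d')" using M_pos by simp
  then have "int (q + 1) dvd int r * (int d - int d')" by (metis dvd_triv_left)
  moreover have "coprime (int (q + 1)) (int r)" using coprime_q1_r coprime_int_iff by blast
  ultimately have "int (q + 1) dvd int d - int d'" using coprime_dvd_mult_right_iff by blast
  moreover have "\<bar>int d - int d'\<bar> < int (q + 1)" using assms(1,2) by (auto simp: exps_def)
  ultimately have "int d = int d'" by (rule dvd_diff_less_imp_eq)
  with f show ?thesis by simp
qed

lemma root_residues_distinct:
  assumes "(d, f) \<in> exps" "(d', f') \<in> exps"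
    and eq: "int (q + 1) * int M * e + int d * int M + int f
      = int (q + 1) * int M * e' + int d' * int M + int f'"
  shows "d = d' \<and> f = f'"
proof -
  have "int f - int f' = int M * (int (q + 1) * (e' - e) + (int d' - int d))"
    using eq by (simp add: algebra_simps)
  then have "int M dvd int f - int f'" by simp
  moreover have "\<bar>int f - int f'\<bar> < int M" using assms(1,2) by (auto simp: exps_def)
  ultimately have "int f = int f'" by (rule dvd_diff_less_imp_eq)
  then have f: "f = f'" by simp
  have "int M * (int (q + 1) * (e' - e)) = int M * (int d - int d')"
    using eq f by (simp add: algebra_simps)
  then have "int (q + 1) * (e' - e) = int d - int d'" using M_pos by simp
  then have "int (q + 1) dvd int d - int d'" by (metis dvd_triv_left)
  moreover have "\<bar>int d - int d'\<bar> < int (q + 1)" using assms(1,2) by (auto simp: exps_def)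
  ultimately have "int d = int d'" by (rule dvd_diff_less_imp_eq)
  with f show ?thesis by simp
qed

lemma separating_inf: "separating term_order_inf"
  unfolding separating_def term_order_inf_def neg_equal_iff_equal
  using inf_residues_distinct by blast

lemma separating_at: "separating (term_order_at u)"
  unfolding separating_def term_order_at_def using root_residues_distinct by blast

text \<open>
  The factor \<open>l\<close> leaves room for values on the coordinate functions with a common divisor; the
  normalisation of \<open>w\<close> will exclude it.
\<close>

definition graded_by :: "('f \<Rightarrow> int) \<Rightarrow> int \<Rightarrow> ('f poly \<Rightarrow> nat \<Rightarrow> nat \<Rightarrow> int) \<Rightarrow> bool" where
  "graded_by w l W \<longleftrightarrow> is_place K w \<and> 0 < l \<and> (\<forall>g d f. g \<in> polys_over K \<longrightarrow> g \<noteq> 0 \<longrightarrow>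
     w (poly g x * y ^ d * z ^ f) = l * W g d f)"

lemma graded_byD:
  "graded_by w l W \<Longrightarrow> g \<in> polys_over K \<Longrightarrow> g \<noteq> 0 \<Longrightarrow> w (poly g x * y ^ d * z ^ f) = l * W g d f"
  unfolding graded_by_def by blast

lemma graded_inf:
  assumes "is_place K w" "w x < 0"
  obtains l where "graded_by w l term_order_inf"
proof -
  interpret place_over K w by unfold_locales (use is_subfield assms in auto)
  have "x \<noteq> 0" using assms val_0 by auto
  have deg: "w (poly g x) = int (degree g) * w x" if "g \<in> polys_over K" "g \<noteq> 0" for g
    using that
  proof (induction g)
    case (pCons u g)
    show ?case
    proof (cases "g = 0")
      case True
      then show ?thesis using pCons by (simp add: polys_pCons val_const)
    next
      case False
      have g: "g \<in> polys_over K" "u \<in> K" using pCons.prems by (auto simp: polys_pCons)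
      then have ne: "x * poly g x \<noteq> 0" using poly_x_nonzero False \<open>x \<noteq> 0\<close> by simp
      then have v: "w (x * poly g x) = (int (degree g) + 1) * w x"
        using pCons.IH g False by (simp add: val_mult distrib_right)
      also have "\<dots> < 0" using assms by (simp add: mult_pos_neg)
      finally have "ord_ge w (w (x * poly g x) + 1) u" using g by (simp add: ord_ge_def val_const)
      from add_dominant[OF ne this] v show ?thesis using False by (simp add: add.commute)
    qed
  qed simp
  obtain l where l: "0 < l" "w x = - l * (int (q + 1) * int M)" "w y = - l * (int r * int M)"
    "w z = - l * (int r * int q ^ 2)"
    using orders_at_pole_of_x[OF assms] .
  have "w (poly g x * y ^ d * z ^ f) = l * term_order_inf g d f" if "g \<in> polys_over K" "g \<noteq> 0" for g d f
    using poly_x_nonzero[OF that] y_nonzero z_nonzero that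
    by (simp add: val_mult val_power deg l term_order_inf_def) (simp add: algebra_simps)
  with l(1) assms show thesis by (intro that[of l]) (simp add: graded_by_def)
qed

lemma graded_at:
  assumes "is_place K w" "0 < w (x - u)" "u \<in> K" "tpoly p a b u = 0"
  shows "graded_by w (w z) (term_order_at u)"
proof -
  interpret place_over K w by unfold_locales (use is_subfield assms in auto)
  have ne: "x - u \<noteq> 0" using x_minus_const_nonzero assms by blast
  have ord: "w (poly g x) = int (order u g) * w (x - u)" if g: "g \<in> polys_over K" "g \<noteq> 0" for g
  proof -
    obtain h where h: "h \<in> polys_over K" "g = [:- u, 1:] ^ order u g * h" "poly h u \<noteq> 0"
      using polys_order_decomp[OF g assms(3)] .
    have k: "h = [:- u, 1:] * synthetic_div h u + [:poly h u:]"
      using synthetic_div_correct'[of u h] by simp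
    have "w x \<ge> 0"
    proof -
      have "ord_ge w 0 ((x - u) + u)"
        using assms by (intro ord_ge_add) (auto simp: ord_ge_def val_const)
      then show ?thesis using val_0 by (auto simp: ord_ge_def)
    qed
    then have "ord_ge w 0 (poly (synthetic_div h u) x)"
      using affine_place_nonneg[OF assms(1)] A_poly_mult[OF polys_synthetic_div[OF h(1) assms(3)] A_1]
      by simp
    moreover have "ord_ge w 1 (x - u)" using assms by (simp add: ord_ge_def)
    ultimately have "ord_ge w (1 + 0) ((x - u) * poly (synthetic_div h u) x)" by (intro ord_ge_mult)
    moreover have "poly h u \<in> K" using h assms by (intro poly_in_K)
    ultimately have "w (poly h u + (x - u) * poly (synthetic_div h u) x) = 0"
      using add_dominant[of "poly h u"] h(3) by (simp add: val_const)
    moreover have "poly h x = poly h u + (x - u) * poly (synthetic_div h u) x"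
      by (subst k) (simp add: algebra_simps)
    ultimately have "w (poly h x) = 0" by simp
    moreover have "poly h x \<noteq> 0" using h that by (intro poly_x_nonzero) auto
    moreover have "poly g x = (x - u) ^ order u g * poly h x"
      by (subst h(2)) (simp add: poly_power)
    ultimately show ?thesis using ne by (simp add: val_mult val_power)
  qed
  note l = orders_at_root_of_t[OF assms]
  have "w (poly g x * y ^ d * z ^ f) = w z * term_order_at u g d f" if "g \<in> polys_over K" "g \<noteq> 0" for g d f
    using poly_x_nonzero[OF that] y_nonzero z_nonzero that
    by (simp add: val_mult val_power ord l(1,2) term_order_at_def) (simp add: algebra_simps)
  with l(3) assms show ?thesis by (simp add: graded_by_def)
qed

text \<open>
  The order of an element of \<open>A\<close> is the least order of its components, since these have
  different orders.
\<close>

lemma order_of_normal_form: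
  assumes w: "graded_by w l W" and W: "separating W"
    and G: "\<And>d f. G d f \<in> polys_over K"
    and h: "h = (\<Sum>(d, f)\<in>exps. poly (G d f) x * y ^ d * z ^ f)" "h \<noteq> 0"
  obtains d f where "(d, f) \<in> exps" "G d f \<noteq> 0" "w h = l * W (G d f) d f"
    "\<And>d' f'. (d', f') \<in> exps \<Longrightarrow> G d' f' \<noteq> 0 \<Longrightarrow> W (G d f) d f \<le> W (G d' f') d' f'"
proof -
  interpret place_over K w by unfold_locales (use is_subfield w in \<open>auto simp: graded_by_def\<close>)
  define t where "t = (\<lambda>(d, f). poly (G d f) x * y ^ d * z ^ f)"
  have t0: "t (d, f) \<noteq> 0 \<longleftrightarrow> G d f \<noteq> 0" for d f
    using poly_x_nonzero[OF G] y_nonzero z_nonzero by (auto simp: t_def)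
  have wt: "w (t (d, f)) = l * W (G d f) d f" if "G d f \<noteq> 0" for d f
    using w G that by (simp add: graded_by_def t_def)
  have l: "l > 0" using w by (simp add: graded_by_def)
  have ht: "h = sum t exps" using h by (simp add: t_def)
  then have "\<exists>i\<in>exps. t i \<noteq> 0" using h(2) by (metis sum.neutral)
  moreover have "i = j" if "i \<in> exps" "j \<in> exps" "t i \<noteq> 0" "t j \<noteq> 0" "w (t i) = w (t j)" for i j
  proof -
    obtain d f d' f' where "i = (d, f)" "j = (d', f')" by (cases i, cases j)
    with that W l t0 wt show ?thesis by (fastforce simp: separating_def)
  qed
  ultimately obtain i where i: "i \<in> exps" "t i \<noteq> 0" "w (sum t exps) = w (t i)"
    "\<And>j. j \<in> exps \<Longrightarrow> t j \<noteq> 0 \<Longrightarrow> w (t i) \<le> w (t j)"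
    using sum_distinct_orders[OF finite_exps, of t] by metis
  obtain d f where df: "i = (d, f)" by (cases i)
  show thesis
  proof (rule that)
    show "(d, f) \<in> exps" "G d f \<noteq> 0" "w h = l * W (G d f) d f"
      using i df t0 wt ht by auto
    show "W (G d f) d f \<le> W (G d' f') d' f'" if "(d', f') \<in> exps" "G d' f' \<noteq> 0" for d' f'
      using i(4)[of "(d', f')"] that i(2) l by (simp add: df t0 wt)
  qed
qed

text \<open>
  By the preceding lemma the weights determine a valuation on \<open>A\<close>, hence on its field of
  fractions, up to a factor, and every value is a multiple of that factor. So there is only one
  place over the pole of \<open>x\<close> and only one over each root of \<open>t\<close>, and its factor is 1.
\<close>

lemma graded_unique:
  assumes v: "graded_by v l W" and w: "graded_by w k W" and W: "separating W"
  shows "v = w" "l = 1"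
proof -
  interpret v: place_over K v by unfold_locales (use is_subfield v in \<open>auto simp: graded_by_def\<close>)
  interpret w: place_over K w by unfold_locales (use is_subfield w in \<open>auto simp: graded_by_def\<close>)
  have on_A: "k * v h = l * w h \<and> l dvd v h" if hA: "h \<in> A" and h0: "h \<noteq> 0" for h
  proof -
    obtain G where G: "\<And>d f. G d f \<in> polys_over K" "h = (\<Sum>(d, f)\<in>exps. poly (G d f) x * y ^ d * z ^ f)"
      using hA by (auto simp: coord_ring_def)
    from order_of_normal_form[OF v W G h0] obtain d f where
      1: "(d, f) \<in> exps" "G d f \<noteq> 0" "v h = l * W (G d f) d f"
      "\<And>d' f'. (d', f') \<in> exps \<Longrightarrow> G d' f' \<noteq> 0 \<Longrightarrow> W (G d f) d f \<le> W (G d' f') d' f'" by blast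
    from order_of_normal_form[OF w W G h0] obtain d' f' where
      2: "(d', f') \<in> exps" "G d' f' \<noteq> 0" "w h = k * W (G d' f') d' f'"
      "\<And>d f. (d, f) \<in> exps \<Longrightarrow> G d f \<noteq> 0 \<Longrightarrow> W (G d' f') d' f' \<le> W (G d f) d f" by blast
    from 1(4)[OF 2(1,2)] 2(4)[OF 1(1,2)] have "W (G d f) d f = W (G d' f') d' f'" by simp
    with 1(3) 2(3) show ?thesis by simp
  qed
  have on_F: "k * v h = l * w h \<and> l dvd v h" if "h \<noteq> 0" for h
  proof -
    obtain f g where fg: "f \<in> A" "g \<in> A" "g \<noteq> 0" "h = f / g" using fraction_of_A .
    then have "f \<noteq> 0" using that by auto
    from on_A[OF fg(1) this] on_A[OF fg(2,3)] show ?thesis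
      unfolding fg(4) v.val_divide[OF \<open>f \<noteq> 0\<close> fg(3)] w.val_divide[OF \<open>f \<noteq> 0\<close> fg(3)]
      by (simp add: right_diff_distrib)
  qed
  show "v = w"
    using v w on_F by (intro proportional_places_eq[of K v w l k]) (auto simp: graded_by_def)
  obtain f where "f \<noteq> 0" "v f = 1" using v by (auto simp: graded_by_def is_place_def)
  with on_F[of f] v show "l = 1" by (auto simp: graded_by_def)
qed

end

section \<open>The discrete valuation at a prime with a local parameter\<close>

text \<open>
  The localisation of \<open>R\<close> at the prime ideal \<open>\<mm>\<close> is a discrete valuation ring as soon as \<open>\<theta>\<close>
  generates its maximal ideal and no nonzero element is divisible by all powers of \<open>\<theta>\<close>. The axioms
  express this without fractions; the elements of \<open>R\<close> outside \<open>\<mm>\<close> become units there.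
\<close>

locale local_parameter = subfield K
  for K :: "'f::field set" +
  fixes R \<mm> :: "'f set" and \<theta> :: 'f
  assumes R_const: "K \<subseteq> R"
    and R_add: "\<And>f g. f \<in> R \<Longrightarrow> g \<in> R \<Longrightarrow> f + g \<in> R"
    and R_mult: "\<And>f g. f \<in> R \<Longrightarrow> g \<in> R \<Longrightarrow> f * g \<in> R"
    and R_fractions: "\<And>h. \<exists>f\<in>R. \<exists>g\<in>R. g \<noteq> 0 \<and> h = f / g"
    and prime_subset: "\<mm> \<subseteq> R" and prime_proper: "1 \<notin> \<mm>"
    and prime_absorb: "\<And>f g. f \<in> R \<Longrightarrow> g \<in> \<mm> \<Longrightarrow> f * g \<in> \<mm>"
    and prime_ideal: "\<And>f g. f \<in> R \<Longrightarrow> g \<in> R \<Longrightarrow> f * g \<in> \<mm> \<Longrightarrow> f \<in> \<mm> \<or> g \<in> \<mm>"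
    and param: "\<theta> \<in> \<mm>" "\<theta> \<noteq> 0"
    and param_divides: "\<And>f. f \<in> \<mm> \<Longrightarrow> \<exists>s\<in>R - \<mm>. \<exists>e\<in>R. s * f = \<theta> * e"
    and param_order_bounded: "\<And>f. f \<in> R \<Longrightarrow> f \<noteq> 0 \<Longrightarrow>
      \<exists>N. \<forall>n. (\<exists>s\<in>R - \<mm>. \<exists>e\<in>R. s * f = \<theta> ^ n * e) \<longrightarrow> n < N"
begin

definition unit :: "'f \<Rightarrow> bool" where
  "unit s \<longleftrightarrow> s \<in> R \<and> s \<notin> \<mm>"

lemma unit_mult: "unit s \<Longrightarrow> unit u \<Longrightarrow> unit (s * u)"
  using prime_ideal R_mult by (auto simp: unit_def)

lemma unit_nonzero: assumes "unit s" shows "s \<noteq> 0"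
proof
  assume "s = 0"
  moreover have "0 * \<theta> \<in> \<mm>" using R_const K_closed(1) param by (intro prime_absorb) auto
  ultimately show False using assms by (simp add: unit_def)
qed

lemma unit_const: assumes "u \<in> K" "u \<noteq> 0" shows "unit u"
proof -
  have "u \<notin> \<mm>"
  proof
    assume "u \<in> \<mm>"
    then have "inverse u * u \<in> \<mm>" using R_const K_closed(6) assms by (intro prime_absorb) auto
    with assms prime_proper show False by simp
  qed
  with assms R_const show ?thesis by (auto simp: unit_def)
qed

lemma unit_1: "unit 1"
  using K_closed(2) by (intro unit_const) auto

lemma R_power: "f \<in> R \<Longrightarrow> f ^ n \<in> R"
  using unit_1 by (induction n) (auto intro: R_mult simp: unit_def)

definition has_order :: "'f \<Rightarrow> int \<Rightarrow> bool" where
  "has_order f k \<longleftrightarrow> (\<exists>s u. unit s \<and> unit u \<and> s * f = \<theta> powi k * u)"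

lemma has_orderI: "unit s \<Longrightarrow> unit u \<Longrightarrow> s * f = \<theta> powi k * u \<Longrightarrow> has_order f k"
  unfolding has_order_def by blast

lemma has_order_le:
  assumes "has_order f k" "has_order f l"
  shows "k \<le> l"
proof (rule ccontr)
  assume "\<not> k \<le> l"
  then obtain n where n: "k = l + int (Suc n)" by (metis add.commute not_le zless_iff_Suc_zadd)
  obtain s u where su: "unit s" "unit u" "s * f = \<theta> powi k * u"
    using assms by (auto simp: has_order_def)
  obtain s' u' where su': "unit s'" "unit u'" "s' * f = \<theta> powi l * u'"
    using assms by (auto simp: has_order_def)
  have "\<theta> powi l * (u' * s) = s * s' * f" using su' by (simp add: mult_ac)
  also have "\<dots> = \<theta> powi k * u * s'" using su by (simp add: mult_ac)
  also have "\<theta> powi k = \<theta> powi l * \<theta> ^ Suc n" unfolding n using param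
    by (subst power_int_add) (simp_all del: of_nat_Suc power_Suc)
  finally have "\<theta> powi l * (u' * s) = \<theta> powi l * (\<theta> ^ Suc n * u * s')" by (simp only: mult.assoc)
  then have "u' * s = (\<theta> ^ n * u * s') * \<theta>" using param by (simp add: mult_ac)
  also have "\<dots> \<in> \<mm>"
    using su su' param prime_subset by (intro prime_absorb R_mult R_power) (auto simp: unit_def)
  finally show False using unit_mult[OF su'(2) su(1)] by (simp add: unit_def)
qed

text \<open>
  Divide by \<open>\<theta>\<close> as long as possible; what remains lies outside \<open>\<mm>\<close>, for otherwise it could be
  divided once more.
\<close>

lemma has_order_of_R:
  assumes "f \<in> R" "f \<noteq> 0"
  shows "\<exists>n. has_order f (int n)"
proof -
  let ?P = "\<lambda>n. \<exists>s. unit s \<and> (\<exists>e\<in>R. s * f = \<theta> ^ n * e)"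
  obtain N where N: "\<And>n. ?P n \<Longrightarrow> n < N"
    using param_order_bounded[OF assms] by (auto simp: unit_def)
  have "?P 0" using unit_1 assms by auto
  then have g: "?P (GREATEST n. ?P n)" using N by (intro GreatestI_nat[of ?P 0 N]) (auto intro: less_imp_le)
  define n where "n = (GREATEST n. ?P n)"
  obtain s e where se: "unit s" "e \<in> R" "s * f = \<theta> ^ n * e" using g by (auto simp: n_def)
  have "e \<notin> \<mm>"
  proof
    assume "e \<in> \<mm>"
    then obtain s' e' where s': "unit s'" "e' \<in> R" "s' * e = \<theta> * e'"
      using param_divides[OF \<open>e \<in> \<mm>\<close>] unfolding unit_def by blast
    have "(s' * s) * f = s' * (s * f)" by (simp only: mult.assoc)
    also have "\<dots> = \<theta> ^ n * (s' * e)" unfolding se(3) by (simp only: mult_ac)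
    also have "\<dots> = \<theta> ^ Suc n * e'" unfolding s'(3) by (simp add: mult_ac)
    finally have "(s' * s) * f = \<theta> ^ Suc n * e'" .
    then have "?P (Suc n)" using unit_mult se s' by blast
    then have "Suc n \<le> n" unfolding n_def using N by (intro Greatest_le_nat[of ?P _ N]) (auto intro: less_imp_le)
    then show False by simp
  qed
  with se have "unit e" "s * f = \<theta> powi int n * e" by (auto simp: unit_def)
  with se(1) show ?thesis by (blast intro: has_orderI)
qed

lemma has_order_divide:
  assumes "has_order f k" "has_order g l" "g \<noteq> 0"
  shows "has_order (f / g) (k - l)"
proof -
  obtain s u where su: "unit s" "unit u" "s * f = \<theta> powi k * u"
    using assms by (auto simp: has_order_def)
  obtain s' u' where su': "unit s'" "unit u'" "s' * g = \<theta> powi l * u'"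
    using assms by (auto simp: has_order_def)
  have "\<theta> powi l * ((s * u') * (f / g)) = (s * f) * (\<theta> powi l * u') / g" by (simp add: mult_ac)
  also have "\<dots> = \<theta> powi k * u * s'" unfolding su'(3)[symmetric] su(3) using assms(3) by simp
  also have "\<theta> powi k = \<theta> powi l * \<theta> powi (k - l)"
    using param by (subst power_int_add[symmetric]) auto
  finally have "\<theta> powi l * ((s * u') * (f / g)) = \<theta> powi l * (\<theta> powi (k - l) * (u * s'))"
    by (simp only: mult.assoc)
  moreover have "\<theta> powi l \<noteq> 0" using param by simp
  ultimately have "(s * u') * (f / g) = \<theta> powi (k - l) * (u * s')" using mult_left_cancel by blast
  from has_orderI[OF _ _ this] su su' show ?thesis by (simp add: unit_mult)
qed

lemma has_order_exists: assumes "h \<noteq> 0" shows "\<exists>k. has_order h k"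
proof -
  obtain f g where "f \<in> R" "g \<in> R" "g \<noteq> 0" "h = f / g" using R_fractions by blast
  moreover from this assms have "f \<noteq> 0" by auto
  ultimately show ?thesis using has_order_of_R has_order_divide by blast
qed

definition order_at :: "'f \<Rightarrow> int" where
  "order_at f = (if f = 0 then 0 else (THE k. has_order f k))"

lemma order_at_eq: "has_order f k \<Longrightarrow> f \<noteq> 0 \<Longrightarrow> order_at f = k"
  using has_order_le[of f] by (auto simp: order_at_def intro!: the_equality intro: antisym)

lemma has_order_at: "f \<noteq> 0 \<Longrightarrow> has_order f (order_at f)"
  using has_order_exists order_at_eq by metis

lemma has_order_mult:
  assumes "has_order f k" "has_order g l"
  shows "has_order (f * g) (k + l)"
proof -
  obtain s u where su: "unit s" "unit u" "s * f = \<theta> powi k * u"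
    using assms by (auto simp: has_order_def)
  obtain s' u' where su': "unit s'" "unit u'" "s' * g = \<theta> powi l * u'"
    using assms by (auto simp: has_order_def)
  have "(s * s') * (f * g) = (s * f) * (s' * g)" by (simp add: mult_ac)
  also have "\<dots> = \<theta> powi (k + l) * (u * u')"
    unfolding su su' using param by (simp add: power_int_add mult_ac)
  finally have "(s * s') * (f * g) = \<theta> powi (k + l) * (u * u')" .
  from has_orderI[OF _ _ this] su su' show ?thesis by (simp add: unit_mult)
qed

lemma has_order_add:
  assumes "has_order f k" "has_order g l" "k \<le> l" "f + g \<noteq> 0"
  shows "\<exists>n\<ge>k. has_order (f + g) n"
proof -
  obtain s u where su: "unit s" "unit u" "s * f = \<theta> powi k * u"
    using assms by (auto simp: has_order_def)
  obtain s' u' where su': "unit s'" "unit u'" "s' * g = \<theta> powi l * u'"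
    using assms by (auto simp: has_order_def)
  obtain n where n: "l = k + int n" using assms(3) zle_iff_zadd by blast
  define e where "e = u * s' + \<theta> ^ n * u' * s"
  have "(s * s') * (f + g) = s' * (s * f) + s * (s' * g)" by (simp add: algebra_simps)
  also have "\<dots> = \<theta> powi k * e"
    unfolding su su' e_def n using param by (simp add: power_int_add algebra_simps)
  finally have e: "(s * s') * (f + g) = \<theta> powi k * e" .
  have "(s * s') * (f + g) \<noteq> 0" using assms(4) unit_nonzero su(1) su'(1) by simp
  then have "e \<noteq> 0" unfolding e by auto
  moreover have "e \<in> R" unfolding e_def using su su' param prime_subset
    by (intro R_add R_mult R_power) (auto simp: unit_def)
  ultimately obtain j where "has_order e (int j)" using has_order_of_R by blast
  then obtain s'' u'' where su'': "unit s''" "unit u''" "s'' * e = \<theta> powi (int j) * u''"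
    by (auto simp: has_order_def)
  have "(s'' * (s * s')) * (f + g) = \<theta> powi k * (s'' * e)" using e by (simp add: mult_ac)
  also have "\<dots> = \<theta> powi (k + int j) * u''"
    unfolding su''(3) using param by (simp add: power_int_add mult.assoc)
  finally have "(s'' * (s * s')) * (f + g) = \<theta> powi (k + int j) * u''" .
  from has_orderI[OF _ _ this] su su' su'' have "has_order (f + g) (k + int j)"
    by (simp add: unit_mult)
  then show ?thesis by (intro exI[of _ "k + int j"]) auto
qed

lemma place_order_at: "is_place K order_at"
  unfolding is_place_def
proof (intro conjI allI impI ballI)
  show "order_at 0 = 0" by (simp add: order_at_def)
  show "order_at (f * g) = order_at f + order_at g" if "f \<noteq> 0 \<and> g \<noteq> 0" for f g
    using that by (intro order_at_eq has_order_mult has_order_at) auto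
  show "min (order_at f) (order_at g) \<le> order_at (f + g)" if "f \<noteq> 0 \<and> g \<noteq> 0 \<and> f + g \<noteq> 0" for f g
  proof (cases "order_at f \<le> order_at g")
    case True
    with has_order_add[of f "order_at f" g "order_at g"] has_order_at that order_at_eq show ?thesis
      by (metis min_def)
  next
    case False
    with has_order_add[of g "order_at g" f "order_at f"] has_order_at that order_at_eq show ?thesis
      by (metis min_def add.commute le_cases)
  qed
  show "order_at u = 0" if "u \<in> K" for u
  proof (cases "u = 0")
    case False
    with unit_const[OF that] have "has_order u 0"
      unfolding has_order_def by (intro exI[of _ 1] exI[of _ u]) (simp add: unit_1)
    with False show ?thesis by (rule order_at_eq[rotated])
  qed (simp add: order_at_def)
  have "has_order \<theta> 1" unfolding has_order_def by (intro exI[of _ 1]) (simp add: unit_1)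
  with param(2) show "\<exists>f. f \<noteq> 0 \<and> order_at f = 1" using order_at_eq by blast
qed

lemma order_at_R: assumes "f \<in> R" shows "0 \<le> order_at f"
proof (cases "f = 0")
  case False
  with has_order_of_R[OF assms] order_at_eq show ?thesis by fastforce
qed (simp add: order_at_def)

lemma denominator_of_regular:
  assumes "0 \<le> order_at h"
  shows "\<exists>s\<in>R - \<mm>. s * h \<in> R"
proof (cases "h = 0")
  case True
  then show ?thesis using unit_1 R_const K_closed(1) by (intro bexI[of _ 1]) (auto simp: unit_def)
next
  case False
  obtain n where n: "order_at h = int n" using assms nonneg_int_cases by blast
  from has_order_at[OF False] obtain s u where su: "unit s" "unit u" "s * h = \<theta> ^ n * u"
    by (auto simp: has_order_def n)
  then have "s * h \<in> R" using param prime_subset by (auto simp: unit_def intro!: R_mult R_power)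
  with su(1) show ?thesis unfolding unit_def by blast
qed

end

text \<open>
  Zorn's lemma for the ideals of a subring of a field; a maximal ideal is prime, since it becomes
  the unit ideal when an element outside it is adjoined.
\<close>

lemma maximal_ideal_exists:
  fixes R I :: "'f::field set"
  assumes R: "1 \<in> R" "\<And>f g. f \<in> R \<Longrightarrow> g \<in> R \<Longrightarrow> f + g \<in> R" "\<And>f g. f \<in> R \<Longrightarrow> g \<in> R \<Longrightarrow> f * g \<in> R"
    and I: "I \<subseteq> R" "0 \<in> I" "1 \<notin> I" "\<And>f g. f \<in> I \<Longrightarrow> g \<in> I \<Longrightarrow> f + g \<in> I"
      "\<And>f g. f \<in> R \<Longrightarrow> g \<in> I \<Longrightarrow> f * g \<in> I"
  obtains \<mm> where "I \<subseteq> \<mm>" "\<mm> \<subseteq> R" "1 \<notin> \<mm>" "\<And>f g. f \<in> \<mm> \<Longrightarrow> g \<in> \<mm> \<Longrightarrow> f + g \<in> \<mm>"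
    "\<And>f g. f \<in> R \<Longrightarrow> g \<in> \<mm> \<Longrightarrow> f * g \<in> \<mm>"
    "\<And>f g. f \<in> R \<Longrightarrow> g \<in> R \<Longrightarrow> f * g \<in> \<mm> \<Longrightarrow> f \<in> \<mm> \<or> g \<in> \<mm>"
proof -
  define \<I> where "\<I> = {J. I \<subseteq> J \<and> J \<subseteq> R \<and> 1 \<notin> J \<and> (\<forall>f\<in>J. \<forall>g\<in>J. f + g \<in> J) \<and> (\<forall>f\<in>R. \<forall>g\<in>J. f * g \<in> J)}"
  have "I \<in> \<I>" using I by (auto simp: \<I>_def)
  have "\<exists>\<mm>\<in>\<I>. \<forall>J\<in>\<I>. \<mm> \<subseteq> J \<longrightarrow> J = \<mm>"
  proof (rule subset_Zorn_nonempty)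
    show "\<I> \<noteq> {}" using \<open>I \<in> \<I>\<close> by auto
    fix \<C> assume C: "\<C> \<noteq> {}" "subset.chain \<I> \<C>"
    then have sub: "\<And>J. J \<in> \<C> \<Longrightarrow> J \<in> \<I>" and lin: "\<And>J L. J \<in> \<C> \<Longrightarrow> L \<in> \<C> \<Longrightarrow> J \<subseteq> L \<or> L \<subseteq> J"
      by (auto simp: subset_chain_def)
    have "f + g \<in> \<Union>\<C>" if fg: "f \<in> \<Union>\<C>" "g \<in> \<Union>\<C>" for f g
    proof -
      obtain J L where J: "J \<in> \<C>" "f \<in> J" and L: "L \<in> \<C>" "g \<in> L" using fg by blast
      define N where "N = (if J \<subseteq> L then L else J)"
      have N: "N \<in> \<C>" "f \<in> N" "g \<in> N" using J L lin[of J L] by (auto simp: N_def)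
      with sub[OF N(1)] have "f + g \<in> N" by (auto simp: \<I>_def)
      with N(1) show ?thesis by blast
    qed
    moreover have "I \<subseteq> \<Union>\<C>" using C(1) sub by (fastforce simp: \<I>_def)
    moreover have "\<Union>\<C> \<subseteq> R" "1 \<notin> \<Union>\<C>" using sub unfolding \<I>_def by blast+
    moreover have "f * g \<in> \<Union>\<C>" if "f \<in> R" "g \<in> \<Union>\<C>" for f g
      using that sub unfolding \<I>_def by blast
    ultimately show "\<Union>\<C> \<in> \<I>" unfolding \<I>_def by blast
  qed
  then obtain \<mm> where m: "\<mm> \<in> \<I>" and max: "\<And>J. J \<in> \<I> \<Longrightarrow> \<mm> \<subseteq> J \<Longrightarrow> J = \<mm>" by blast
  have m': "I \<subseteq> \<mm>" "\<mm> \<subseteq> R" "1 \<notin> \<mm>" "\<And>f g. f \<in> \<mm> \<Longrightarrow> g \<in> \<mm> \<Longrightarrow> f + g \<in> \<mm>"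
    "\<And>f g. f \<in> R \<Longrightarrow> g \<in> \<mm> \<Longrightarrow> f * g \<in> \<mm>" using m by (auto simp: \<I>_def)
  have "g \<in> \<mm>" if f: "f \<in> R" "g \<in> R" "f * g \<in> \<mm>" "f \<notin> \<mm>" for f g
  proof -
    define J where "J = {e + s * f | e s. e \<in> \<mm> \<and> s \<in> R}"
    have "0 \<in> \<mm>" using m' I by auto
    have mJ: "\<mm> \<subseteq> J"
    proof
      fix e assume "e \<in> \<mm>"
      then show "e \<in> J" unfolding J_def using I \<open>0 \<in> \<mm>\<close> m'(2)
        by (intro CollectI exI[of _ e] exI[of _ 0]) auto
    qed
    have fJ: "f \<in> J" unfolding J_def using R \<open>0 \<in> \<mm>\<close> by (intro CollectI exI[of _ 0] exI[of _ 1]) auto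
    have "J \<notin> \<I>" using max[OF _ mJ] fJ f(4) by auto
    moreover have "J \<subseteq> R" using R m' f by (auto simp: J_def)
    moreover have "e + e' \<in> J" if ee: "e \<in> J" "e' \<in> J" for e e'
    proof -
      obtain d s d' s' where "d \<in> \<mm>" "s \<in> R" "e = d + s * f" "d' \<in> \<mm>" "s' \<in> R" "e' = d' + s' * f"
        using ee unfolding J_def by blast
      then show ?thesis unfolding J_def
        by (intro CollectI exI[of _ "d + d'"] exI[of _ "s + s'"]) (auto simp: m' R algebra_simps)
    qed
    moreover have "s' * e \<in> J" if "s' \<in> R" and e: "e \<in> J" for e s'
    proof -
      obtain d s where "d \<in> \<mm>" "s \<in> R" "e = d + s * f" using e unfolding J_def by blast
      moreover have "s' * d \<in> \<mm>" "s' * s \<in> R" using \<open>s' \<in> R\<close> calculation by (auto intro: m' R)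
      ultimately show ?thesis unfolding J_def
        by (intro CollectI exI[of _ "s' * d"] exI[of _ "s' * s"]) (simp add: algebra_simps)
    qed
    ultimately have "1 \<in> J" using mJ m'(1) unfolding \<I>_def by blast
    then obtain e s where es: "e \<in> \<mm>" "s \<in> R" "1 = e + s * f" by (auto simp: J_def)
    have "g = g * (e + s * f)" unfolding es(3)[symmetric] by simp
    also have "\<dots> = g * e + s * (f * g)" by (simp add: algebra_simps)
    also have "g * e + s * (f * g) \<in> \<mm>" by (rule m'(4)[OF m'(5)[OF f(2) es(1)] m'(5)[OF es(2) f(3)]])
    finally show ?thesis .
  qed
  then have "f \<in> \<mm> \<or> g \<in> \<mm>" if "f \<in> R" "g \<in> R" "f * g \<in> \<mm>" for f g using that by blast
  with m' show thesis by (rule that)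
qed

section \<open>Functions with poles only at infinity\<close>

locale projective_curve = affine_curve K p a b q r M c x y z
  for K :: "'f::field set" and p a b q r M c x y z +
  fixes Pinf :: "'f \<Rightarrow> int"
  assumes rational_inf: "rational_place K Pinf" and pole_x: "Pinf x < 0"
begin

sublocale inf: place_over K Pinf
  by unfold_locales (use is_subfield rational_inf in \<open>auto simp: rational_place_def\<close>)

lemma x_nonzero: "x \<noteq> 0"
  using pole_x inf.val_0 by auto

lemma graded_Pinf: "graded_by Pinf 1 term_order_inf"
proof -
  obtain l where "graded_by Pinf l term_order_inf" using graded_inf[OF inf.place pole_x] .
  with graded_unique(2)[OF this this separating_inf] show ?thesis by simp
qed

lemma place_with_pole_of_x_eq:
  assumes "is_place K w" "w x < 0"
  shows "w = Pinf"
  using graded_inf[OF assms] graded_unique(1)[OF _ graded_Pinf separating_inf] by metis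

lemma Pinf_term:
  "g \<in> polys_over K \<Longrightarrow> g \<noteq> 0 \<Longrightarrow> Pinf (poly g x * y ^ d * z ^ f) = term_order_inf g d f"
  using graded_Pinf by (simp add: graded_by_def)

lemma Pinf_x: "Pinf x = - int ((q + 1) * M)"
  using Pinf_term[of "[:0, 1:]" 0 0] by (simp add: polys_pCons polys_0 K_closed term_order_inf_def algebra_simps)

lemma Pinf_z: "Pinf z = - int (r * q ^ 2)"
  using Pinf_term[of 1 0 1] by (simp add: polys_1 term_order_inf_def)

lemma Pinf_A: assumes "f \<in> A" shows "Pinf f \<le> 0"
proof (cases "f = 0")
  case False
  obtain G where G: "\<And>d e. G d e \<in> polys_over K" "f = (\<Sum>(d, e)\<in>exps. poly (G d e) x * y ^ d * z ^ e)"
    using assms by (auto simp: coord_ring_def)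
  obtain d e where "Pinf f = 1 * term_order_inf (G d e) d e"
    by (rule order_of_normal_form[OF graded_Pinf separating_inf G False])
  moreover have "term_order_inf (G d e) d e \<le> 0" unfolding term_order_inf_def
    by (simp only: neg_le_0_iff_le) (intro add_nonneg_nonneg mult_nonneg_nonneg; simp)
  ultimately show ?thesis by simp
qed (simp add: inf.val_0)

text \<open>
  The point at infinity has residue field \<open>K\<close>, so the quotient of two functions of equal pole order
  has a nonzero constant as its value there.
\<close>

lemma cancel_leading_term:
  assumes "f \<noteq> 0" "g \<noteq> 0" "Pinf f = Pinf g"
  obtains u where "u \<in> K" "ord_ge Pinf (Pinf f + 1) (f - u * g)"
proof -
  have "Pinf (f / g) = 0" using assms by (simp add: inf.val_divide)
  then have "regular_at Pinf (f / g)" by (simp add: regular_at_def)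
  then obtain u where u: "u \<in> K" "vanishes_at Pinf (f / g - u)"
    using rational_inf by (auto simp: rational_place_def)
  then have "ord_ge Pinf 1 (f / g - u)" by (auto simp: vanishes_at_def ord_ge_def)
  moreover have "ord_ge Pinf (Pinf f) g" using assms by (simp add: ord_ge_def)
  ultimately have "ord_ge Pinf (Pinf f + 1) (g * (f / g - u))" by (intro inf.ord_ge_mult)
  moreover have "g * (f / g - u) = f - u * g" using assms by (simp add: field_simps)
  ultimately show thesis using that u by simp
qed

definition pole_bounded :: "nat \<Rightarrow> 'f set" where
  "pole_bounded N = {f \<in> A. ord_ge Pinf (- int N) f}"

lemma pole_bounded_cases:
  assumes "f \<in> pole_bounded (Suc N)"
  shows "f \<in> pole_bounded N \<or> f \<noteq> 0 \<and> Pinf f = - int (Suc N)"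
  using assms by (auto simp: pole_bounded_def ord_ge_def)

text \<open>
  Raising the bound by one enlarges the space by at most one dimension over the finite field
  \<open>K\<close>, by cancellation of leading terms.
\<close>

lemma finite_pole_bounded: "finite (pole_bounded N)"
proof (induction N)
  case 0
  have "pole_bounded 0 \<subseteq> K"
  proof
    fix f assume "f \<in> pole_bounded 0"
    then have f: "f \<in> A" "regular_at Pinf f" by (auto simp: pole_bounded_def ord_ge_def regular_at_def)
    then obtain u where u: "u \<in> K" "vanishes_at Pinf (f - u)"
      using rational_inf by (auto simp: rational_place_def)
    then have "f - u \<in> A" using f K_subset_A by (intro A_diff) auto
    then show "f \<in> K" using Pinf_A[of "f - u"] u by (auto simp: vanishes_at_def)
  qed
  then show ?case using finite_K finite_subset by blast
next
  case (Suc N)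
  show ?case
  proof (cases "\<exists>g\<in>pole_bounded (Suc N). g \<noteq> 0 \<and> Pinf g = - int (Suc N)")
    case False
    then have "pole_bounded (Suc N) \<subseteq> pole_bounded N" using pole_bounded_cases by blast
    then show ?thesis using Suc finite_subset by blast
  next
    case True
    then obtain g where g: "g \<in> A" "g \<noteq> 0" "Pinf g = - int (Suc N)" by (auto simp: pole_bounded_def)
    have "pole_bounded (Suc N) \<subseteq> pole_bounded N \<union> (\<lambda>(u, e). e + u * g) ` (K \<times> pole_bounded N)"
    proof
      fix f assume f: "f \<in> pole_bounded (Suc N)"
      show "f \<in> pole_bounded N \<union> (\<lambda>(u, e). e + u * g) ` (K \<times> pole_bounded N)"
      proof (cases "f \<in> pole_bounded N")
        case False
        then have f': "f \<noteq> 0" "Pinf f = - int (Suc N)" using pole_bounded_cases[OF f] by auto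
        then obtain u where u: "u \<in> K" "ord_ge Pinf (- int (Suc N) + 1) (f - u * g)"
          using cancel_leading_term[of f g] g by metis
        have "f - u * g \<in> A" using f u g K_subset_A by (intro A_diff A_mult) (auto simp: pole_bounded_def)
        then have "f - u * g \<in> pole_bounded N" using u by (simp add: pole_bounded_def)
        then show ?thesis using u(1) by (intro UnI2 image_eqI[of _ _ "(u, f - u * g)"]) auto
      qed auto
    qed
    then show ?thesis using Suc finite_K by (meson finite_SigmaI finite_UnI finite_imageI finite_subset)
  qed
qed

text \<open>
  The pole orders \<open>(q + 1) M\<close> of \<open>x\<close> and \<open>r q\<^sup>2\<close> of \<open>z\<close> are coprime, so that they generate
  a numerical semigroup.
\<close>

lemma all_large_pole_orders:
  assumes "n \<ge> (q + 1) * M * (r * q ^ 2)"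
  obtains f where "f \<in> A" "f \<noteq> 0" "Pinf f = - int n"
proof -
  define X Z where "X = (q + 1) * M" and "Z = r * q ^ 2"
  have "coprime (q + 1) q" by simp
  then have "coprime (q + 1) Z" using coprime_q1_r by (simp add: Z_def)
  then have "coprime X Z" using coprime_M_powers unfolding X_def Z_def by (simp only: coprime_mult_left_iff simp_thms)
  then have "coprime Z X" by (simp add: coprime_commute)
  then obtain t where t: "[Z * t = 1] (mod X)" using cong_solve_coprime_nat[of Z X] by auto
  have "X > 0" using M_pos by (simp add: X_def)
  define k where "k = (t * n) mod X"
  have "[Z * k = Z * (t * n)] (mod X)" unfolding k_def by (intro cong_scalar_left) (simp add: cong_def)
  also have "Z * (t * n) = (Z * t) * n" by simp
  also have "[(Z * t) * n = 1 * n] (mod X)" using t by (rule cong_scalar_right)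
  finally have cong: "[n = Z * k] (mod X)" by (simp add: cong_sym)
  have "k \<le> X" using \<open>X > 0\<close> by (simp add: k_def less_imp_le)
  then have "Z * k \<le> X * Z" by (simp add: mult.commute)
  also have "X * Z \<le> n" using assms by (simp only: X_def Z_def)
  finally have "Z * k \<le> n" .
  with cong obtain j where j: "n = Z * k + j * X"
    using cong_le_nat[of "Z * k" n X] cong_sym by (metis add.commute)
  have "Pinf (x ^ j * z ^ k) = int j * Pinf x + int k * Pinf z"
    using x_nonzero z_nonzero by (simp add: inf.val_mult inf.val_power)
  also have "\<dots> = - int n" unfolding j Pinf_x Pinf_z X_def Z_def by (simp add: algebra_simps)
  finally show thesis using x_nonzero z_nonzero A_x_y_z
    by (intro that[of "x ^ j * z ^ k"]) (auto intro: A_mult A_power)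
qed

text \<open>
  The ring \<open>A\<close> is finite modulo any nonzero \<open>g\<close>: multiples of \<open>g\<close> realise every large pole order,
  so they can be used to lower the pole order of \<open>f\<close> below a fixed bound. This replaces norms and
  integral dependence over \<open>K[z]\<close>.
\<close>

lemma bounded_representatives:
  assumes g: "g \<in> A" "g \<noteq> 0"
  obtains N where "\<And>f. f \<in> A \<Longrightarrow> \<exists>f'\<in>pole_bounded N. \<exists>e\<in>A. f = f' + g * e"
proof -
  obtain k where k: "Pinf g = - int k" using Pinf_A[OF g(1)] by (metis nonpos_int_cases)
  define N where "N = (q + 1) * M * (r * q ^ 2) + k"
  have red: "\<exists>f'\<in>pole_bounded N. \<exists>e\<in>A. f = f' + g * e" if "f \<in> pole_bounded n" for f n
    using that
  proof (induction n arbitrary: f)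
    case 0
    then have "f \<in> pole_bounded N" by (auto simp: pole_bounded_def ord_ge_def)
    then show ?case using A_0 by force
  next
    case (Suc n)
    show ?case
    proof (cases "Suc n \<le> N \<or> f \<in> pole_bounded n")
      case True
      then have "f \<in> pole_bounded N \<or> f \<in> pole_bounded n"
        using Suc.prems by (auto simp: pole_bounded_def ord_ge_def)
      then show ?thesis using Suc.IH A_0 by force
    next
      case False
      then have f: "f \<noteq> 0" "Pinf f = - int (Suc n)" using pole_bounded_cases[OF Suc.prems] by auto
      obtain h where h: "h \<in> A" "h \<noteq> 0" "Pinf h = - int (Suc n - k)"
      proof (rule all_large_pole_orders)
        show "(q + 1) * M * (r * q ^ 2) \<le> Suc n - k" using False unfolding N_def by linarith
      qed
      have "Pinf (g * h) = - int (Suc n)" using g h k False by (simp add: inf.val_mult N_def)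
      then obtain u where u: "u \<in> K" "ord_ge Pinf (- int (Suc n) + 1) (f - u * (g * h))"
        using cancel_leading_term[of f "g * h"] f g h by (metis no_zero_divisors)
      have uA: "u \<in> A" using u K_subset_A by auto
      have "f \<in> A" using Suc.prems by (simp add: pole_bounded_def)
      then have "f - u * (g * h) \<in> pole_bounded n"
        using u uA g h by (simp add: pole_bounded_def A_diff A_mult)
      from Suc.IH[OF this] obtain f' e where "f' \<in> pole_bounded N" "e \<in> A" "f - u * (g * h) = f' + g * e"
        by blast
      moreover from this have "f = f' + g * (e + u * h)" by (simp add: algebra_simps)
      ultimately show ?thesis using uA h by (blast intro: A_add A_mult)
    qed
  qed
  show thesis
  proof (rule that)
    fix f assume f: "f \<in> A"
    then obtain n where "Pinf f = - int n" using Pinf_A by (metis nonpos_int_cases)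
    with f red[of f n] show "\<exists>f'\<in>pole_bounded N. \<exists>e\<in>A. f = f' + g * e"
      by (simp add: pole_bounded_def ord_ge_def)
  qed
qed

lemma pigeonhole_mod_principal:
  fixes F :: "nat \<Rightarrow> 'f"
  assumes g: "g \<in> A" "g \<noteq> 0" and F: "\<And>n. F n \<in> A"
  obtains i j e where "i < j" "e \<in> A" "F j - F i = g * e"
proof -
  obtain N where N: "\<And>f. f \<in> A \<Longrightarrow> \<exists>f'\<in>pole_bounded N. \<exists>e\<in>A. f = f' + g * e"
    using bounded_representatives[OF g] by blast
  then have "\<forall>n. \<exists>f'\<in>pole_bounded N. \<exists>e\<in>A. F n = f' + g * e" using F by blast
  then obtain \<rho> where \<rho>: "\<And>n. \<rho> n \<in> pole_bounded N" "\<And>n. \<exists>e\<in>A. F n = \<rho> n + g * e" by metis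
  have "\<not> inj \<rho>"
  proof
    assume "inj \<rho>"
    moreover have "range \<rho> \<subseteq> pole_bounded N" using \<rho>(1) by auto
    ultimately show False using finite_pole_bounded[of N] finite_subset finite_imageD infinite_UNIV_nat by metis
  qed
  then obtain i j where ij: "i < j" "\<rho> i = \<rho> j" unfolding inj_def by (metis linorder_neqE_nat)
  obtain e e' where "e \<in> A" "F i = \<rho> i + g * e" "e' \<in> A" "F j = \<rho> j + g * e'" using \<rho>(2) by meson
  with ij have "F j - F i = g * (e' - e)" "e' - e \<in> A" by (auto simp: algebra_simps A_diff)
  with ij(1) show thesis using that by blast
qed

lemma frobenius_add: "(f + g) ^ (p ^ N) = f ^ (p ^ N) + g ^ (p ^ N)" for f g :: 'f
  using char_p prime_p by (intro freshmans_dream') auto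

lemma frobenius_diff: "(f - g) ^ (p ^ N) = f ^ (p ^ N) - g ^ (p ^ N)" for f g :: 'f
  using frobenius_add[of "f - g" g N] by simp

lemma frobenius_sum: "sum f I ^ (p ^ N) = (\<Sum>i\<in>I. f i ^ (p ^ N))" for f :: "'i \<Rightarrow> 'f"
  using char_p prime_p by (intro freshmans_dream_sum') auto

definition cong_mod :: "'f \<Rightarrow> 'f \<Rightarrow> 'f \<Rightarrow> bool" where
  "cong_mod \<theta> f g \<longleftrightarrow> (\<exists>e\<in>A. f - g = \<theta> * e)"

lemma cong_mod_refl: "cong_mod \<theta> f f"
  unfolding cong_mod_def using A_0 by (intro bexI[of _ 0]) auto

lemma cong_mod_trans: assumes "cong_mod \<theta> f g" "cong_mod \<theta> g h" shows "cong_mod \<theta> f h"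
proof -
  obtain e e' where "e \<in> A" "f - g = \<theta> * e" "e' \<in> A" "g - h = \<theta> * e'"
    using assms by (auto simp: cong_mod_def)
  then show ?thesis unfolding cong_mod_def
    by (intro bexI[of _ "e + e'"]) (auto simp: algebra_simps A_add)
qed

lemma cong_mod_add: assumes "cong_mod \<theta> f g" "cong_mod \<theta> f' g'" shows "cong_mod \<theta> (f + f') (g + g')"
proof -
  obtain e e' where "e \<in> A" "f - g = \<theta> * e" "e' \<in> A" "f' - g' = \<theta> * e'"
    using assms by (auto simp: cong_mod_def)
  then show ?thesis unfolding cong_mod_def
    by (intro bexI[of _ "e + e'"]) (auto simp: algebra_simps A_add)
qed

lemma cong_mod_mult:
  assumes "cong_mod \<theta> f g" "cong_mod \<theta> f' g'" "f' \<in> A" "g \<in> A"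
  shows "cong_mod \<theta> (f * f') (g * g')"
proof -
  obtain e e' where e: "e \<in> A" "f - g = \<theta> * e" "e' \<in> A" "f' - g' = \<theta> * e'"
    using assms by (auto simp: cong_mod_def)
  have "f * f' - g * g' = (f - g) * f' + g * (f' - g')" by (simp add: algebra_simps)
  also have "\<dots> = \<theta> * (e * f' + g * e')" using e by (simp add: algebra_simps)
  finally show ?thesis unfolding cong_mod_def using e assms by (blast intro: A_add A_mult)
qed

lemma cong_mod_power:
  assumes "cong_mod \<theta> f g" "f \<in> A" "g \<in> A"
  shows "cong_mod \<theta> (f ^ n) (g ^ n)"
  using assms by (induction n) (auto intro: cong_mod_refl cong_mod_mult A_power)

text \<open>
  If all of \<open>A\<close> is Frobenius periodic, then \<open>A / \<theta> A\<close> is reduced, so that \<open>\<theta>\<close> is a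
  local parameter at every prime that contains it.
\<close>

definition frobenius_periodic :: "'f \<Rightarrow> 'f set" where
  "frobenius_periodic \<theta> = {f \<in> A. \<exists>k\<ge>1. cong_mod \<theta> (f ^ (p ^ k)) f}"

lemma frobenius_iterate:
  assumes "f \<in> A" "cong_mod \<theta> (f ^ (p ^ k)) f"
  shows "cong_mod \<theta> (f ^ (p ^ (k * l))) f"
proof (induction l)
  case (Suc l)
  have "f ^ (p ^ (k * Suc l)) = (f ^ (p ^ (k * l))) ^ (p ^ k)"
    by (simp add: power_add mult.commute flip: power_mult)
  moreover have "cong_mod \<theta> ((f ^ (p ^ (k * l))) ^ (p ^ k)) (f ^ (p ^ k))"
    using Suc assms by (intro cong_mod_power A_power)
  ultimately show ?case using assms cong_mod_trans by metis
qed (simp add: cong_mod_refl)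

lemma frobenius_periodic_common:
  assumes "f \<in> frobenius_periodic \<theta>" "g \<in> frobenius_periodic \<theta>"
  obtains k where "k \<ge> 1" "cong_mod \<theta> (f ^ (p ^ k)) f" "cong_mod \<theta> (g ^ (p ^ k)) g"
proof -
  obtain k l where kl: "k \<ge> 1" "l \<ge> 1" "f \<in> A" "g \<in> A"
    "cong_mod \<theta> (f ^ (p ^ k)) f" "cong_mod \<theta> (g ^ (p ^ l)) g"
    using assms by (auto simp: frobenius_periodic_def)
  then have "cong_mod \<theta> (f ^ (p ^ (k * l))) f" "cong_mod \<theta> (g ^ (p ^ (l * k))) g"
    by (auto intro: frobenius_iterate)
  with kl(1,2) show thesis by (intro that[of "k * l"]) (auto simp: mult.commute)
qed

lemma frobenius_periodic_add:
  assumes "f \<in> frobenius_periodic \<theta>" "g \<in> frobenius_periodic \<theta>"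
  shows "f + g \<in> frobenius_periodic \<theta>"
proof -
  obtain k where k: "k \<ge> 1" "cong_mod \<theta> (f ^ (p ^ k)) f" "cong_mod \<theta> (g ^ (p ^ k)) g"
    using frobenius_periodic_common[OF assms] .
  from cong_mod_add[OF k(2,3)] have "cong_mod \<theta> ((f + g) ^ (p ^ k)) (f + g)" by (simp add: frobenius_add)
  with k(1) assms show ?thesis by (auto simp: frobenius_periodic_def A_add)
qed

lemma frobenius_periodic_mult:
  assumes "f \<in> frobenius_periodic \<theta>" "g \<in> frobenius_periodic \<theta>"
  shows "f * g \<in> frobenius_periodic \<theta>"
proof -
  obtain k where k: "k \<ge> 1" "cong_mod \<theta> (f ^ (p ^ k)) f" "cong_mod \<theta> (g ^ (p ^ k)) g"
    using frobenius_periodic_common[OF assms] .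
  have "f \<in> A" "g \<in> A" using assms by (auto simp: frobenius_periodic_def)
  then have "cong_mod \<theta> ((f * g) ^ (p ^ k)) (f * g)"
    using cong_mod_mult[OF k(2,3)] by (simp add: power_mult_distrib A_power)
  with k(1) \<open>f \<in> A\<close> \<open>g \<in> A\<close> show ?thesis by (auto simp: frobenius_periodic_def A_mult)
qed

lemma frobenius_periodic_K: "K \<subseteq> frobenius_periodic \<theta>"
proof
  fix u assume u: "u \<in> K"
  have "\<not> inj (\<lambda>n. u ^ (p ^ n))"
  proof
    assume "inj (\<lambda>n. u ^ (p ^ n))"
    moreover have "range (\<lambda>n. u ^ (p ^ n)) \<subseteq> K" using K_power[OF u] by auto
    ultimately show False using finite_K finite_subset finite_imageD infinite_UNIV_nat by metis
  qed
  then obtain i j where ij: "i < j" "u ^ (p ^ i) = u ^ (p ^ j)"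
    unfolding inj_def by (metis linorder_neqE_nat)
  have "(u ^ (p ^ (j - i)) - u) ^ (p ^ i) = u ^ (p ^ (j - i + i)) - u ^ (p ^ i)"
    by (simp add: frobenius_diff power_add flip: power_mult)
  then have "u ^ (p ^ (j - i)) = u" using ij by simp
  then show "u \<in> frobenius_periodic \<theta>" unfolding frobenius_periodic_def
    using u K_subset_A ij(1) cong_mod_refl[of \<theta> u] by (intro CollectI conjI exI[of _ "j - i"]) auto
qed

lemma frobenius_periodic_power: "f \<in> frobenius_periodic \<theta> \<Longrightarrow> f ^ n \<in> frobenius_periodic \<theta>"
  using frobenius_periodic_K[of \<theta>] K_closed(2) by (induction n) (auto intro: frobenius_periodic_mult)

lemma frobenius_periodic_diff:
  assumes "f \<in> frobenius_periodic \<theta>" "g \<in> frobenius_periodic \<theta>"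
  shows "f - g \<in> frobenius_periodic \<theta>"
proof -
  have "-1 \<in> frobenius_periodic \<theta>" using frobenius_periodic_K[of \<theta>] K_closed(2,5) by blast
  from frobenius_periodic_add[OF assms(1) frobenius_periodic_mult[OF this assms(2)]] show ?thesis by simp
qed

lemma frobenius_periodic_sum:
  "(\<And>i. i \<in> I \<Longrightarrow> f i \<in> frobenius_periodic \<theta>) \<Longrightarrow> sum f I \<in> frobenius_periodic \<theta>"
  using frobenius_periodic_K[of \<theta>] K_closed(1)
  by (induction I rule: infinite_finite_induct) (auto intro: frobenius_periodic_add)

text \<open>
  The Frobenius orbit of \<open>f\<close> in the finite ring \<open>A / \<theta> A\<close> runs into a cycle.
\<close>

lemma frobenius_periodic_eventually:
  assumes "\<theta> \<in> A" "\<theta> \<noteq> 0" "f \<in> A"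
  obtains i where "\<And>N. N \<ge> i \<Longrightarrow> f ^ (p ^ N) \<in> frobenius_periodic \<theta>"
proof -
  obtain i j e where ij: "i < j" "e \<in> A" "f ^ (p ^ j) - f ^ (p ^ i) = \<theta> * e"
    using pigeonhole_mod_principal[OF assms(1,2), of "\<lambda>n. f ^ (p ^ n)"] A_power[OF assms(3)] by blast
  have "(f ^ (p ^ i)) ^ (p ^ (j - i)) = f ^ (p ^ j)"
    using ij(1) by (simp flip: power_mult power_add)
  then have "f ^ (p ^ i) \<in> frobenius_periodic \<theta>"
    unfolding frobenius_periodic_def cong_mod_def using ij A_power[OF assms(3)]
    by (intro CollectI conjI exI[of _ "j - i"]) auto
  then have "(f ^ (p ^ i)) ^ (p ^ (N - i)) \<in> frobenius_periodic \<theta>" for N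
    by (rule frobenius_periodic_power)
  moreover have "(f ^ (p ^ i)) ^ (p ^ (N - i)) = f ^ (p ^ N)" if "N \<ge> i" for N
    using that by (simp flip: power_mult power_add)
  ultimately show thesis using that by metis
qed

text \<open>
  Since the orbit is eventually periodic, it suffices to be able to step back: periodicity of the
  later members must imply that of the earlier ones.
\<close>

lemma frobenius_periodic_descend:
  assumes "\<theta> \<in> A" "\<theta> \<noteq> 0" "f \<in> A"
    and step: "\<And>N. (\<And>N'. N' > N \<Longrightarrow> f ^ (p ^ N') \<in> frobenius_periodic \<theta>) \<Longrightarrow>
      f ^ (p ^ N) \<in> frobenius_periodic \<theta>"
  shows "f \<in> frobenius_periodic \<theta>"
proof -
  obtain i where i: "\<And>N. N \<ge> i \<Longrightarrow> f ^ (p ^ N) \<in> frobenius_periodic \<theta>"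
    using frobenius_periodic_eventually[OF assms(1-3)] by blast
  have "f ^ (p ^ N) \<in> frobenius_periodic \<theta>" for N
  proof (induction "i - N" arbitrary: N rule: less_induct)
    case less
    show ?case
    proof (rule step)
      fix N' assume "N' > N"
      then show "f ^ (p ^ N') \<in> frobenius_periodic \<theta>"
        using i[of N'] less[of N'] by (cases "N' \<ge> i") auto
    qed
  qed
  from this[of 0] show ?thesis by simp
qed

lemma separable_param:
  assumes "k \<ge> 1"
  shows "z ^ (p ^ k) - z \<in> A" "z ^ (p ^ k) - z \<noteq> 0"
proof -
  show "z ^ (p ^ k) - z \<in> A" using A_x_y_z by (intro A_diff A_power)
  have "p ^ 0 < p ^ k" using prime_gt_1_nat[OF prime_p] assms by (intro power_strict_increasing) auto
  then have "p ^ k \<noteq> 1" unfolding power_0 by (rule less_imp_neq[symmetric])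
  then have "int (p ^ k) \<noteq> 1" by (simp only: of_nat_eq_1_iff not_False_eq_True)
  moreover have "Pinf z \<noteq> 0" using r_pos q_ge_2 by (simp add: Pinf_z)
  ultimately have "Pinf (z ^ (p ^ k)) \<noteq> Pinf z"
    using z_nonzero by (simp add: inf.val_power del: of_nat_power)
  then show "z ^ (p ^ k) - z \<noteq> 0" by auto
qed

text \<open>
  This is the smoothness of the affine curve. The equations express \<open>y\<close> through \<open>z\<close> and \<open>p\<close>-th powers
  of \<open>y\<close>, and \<open>x\<close> through \<open>y\<close> and \<open>p\<close>-th powers of \<open>x\<close>:
  \<open>y = y\<^bsup>q\<^sup>2\<^esup> - z\<^sup>M\<close> and \<open>x = c y\<^bsup>q+1\<^esup> - (t(x) - x)\<close>, where \<open>t(x) - x\<close> is a sum of \<open>p\<close>-th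
  powers; in other words \<open>A\<close> is etale over \<open>K[z]\<close>. Raising these identities to the power \<open>p\<^sup>N\<close> gives
  the step back along Frobenius orbits.
\<close>

lemma A_frobenius_periodic:
  assumes "k \<ge> 1"
  shows "A \<subseteq> frobenius_periodic (z ^ (p ^ k) - z)" (is "A \<subseteq> ?P")
proof (rule A_induct)
  note \<theta> = separable_param[OF assms]
  show z: "z \<in> ?P" unfolding frobenius_periodic_def cong_mod_def
    using assms A_x_y_z A_1 by (intro CollectI conjI exI[of _ k] bexI[of _ 1]) auto
  show y: "y \<in> ?P"
  proof (rule frobenius_periodic_descend[OF \<theta> A_x_y_z(2)])
    fix N assume IH: "\<And>N'. N' > N \<Longrightarrow> y ^ (p ^ N') \<in> ?P"
    have "y = y ^ (p ^ (2 * a)) - z ^ M"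
      using eq_yz by (simp add: q_def algebra_simps flip: power_mult)
    then have "y ^ (p ^ N) = (y ^ (p ^ (2 * a))) ^ (p ^ N) - (z ^ M) ^ (p ^ N)"
      using frobenius_diff by metis
    also have "(y ^ (p ^ (2 * a))) ^ (p ^ N) = y ^ (p ^ (2 * a + N))" by (simp flip: power_mult power_add)
    finally show "y ^ (p ^ N) \<in> ?P"
      using a_pos z by (auto intro!: frobenius_periodic_diff frobenius_periodic_power IH)
  qed
  show "x \<in> ?P"
  proof (rule frobenius_periodic_descend[OF \<theta> A_x_y_z(1)])
    fix N assume IH: "\<And>N'. N' > N \<Longrightarrow> x ^ (p ^ N') \<in> ?P"
    obtain l where l: "a div b = Suc l" using a_div_b by blast
    have "tpoly p a b x = x + (\<Sum>i<l. x ^ (p ^ (Suc i * b)))"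
      unfolding tpoly_def l by (subst sum.lessThan_Suc_shift) simp
    then have "x = c * y ^ (q + 1) - (\<Sum>i<l. x ^ (p ^ (Suc i * b)))" using eq_xy by simp
    then have "x ^ (p ^ N) = (c * y ^ (q + 1)) ^ (p ^ N) - (\<Sum>i<l. (x ^ (p ^ (Suc i * b))) ^ (p ^ N))"
      using frobenius_diff frobenius_sum by metis
    also have "(\<Sum>i<l. (x ^ (p ^ (Suc i * b))) ^ (p ^ N)) = (\<Sum>i<l. x ^ (p ^ (Suc i * b + N)))"
      by (simp only: power_mult[symmetric] power_add[symmetric])
    finally show "x ^ (p ^ N) \<in> ?P"
      using b_pos y c_in_K frobenius_periodic_K
      by (auto intro!: frobenius_periodic_diff frobenius_periodic_mult frobenius_periodic_power
          frobenius_periodic_sum IH)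
  qed
qed (use frobenius_periodic_K frobenius_periodic_add frobenius_periodic_mult in auto)

text \<open>
  Among the powers \<open>z\<^bsup>p\<^sup>n\<^esup>\<close> two agree modulo \<open>f\<close>, and in characteristic \<open>p\<close> their difference is a
  power of \<open>z\<^bsup>p\<^sup>k\<^esup> - z\<close>. Thus every nonzero ideal of \<open>A\<close> contains a power of such a polynomial.
\<close>

lemma divides_separable_power:
  assumes "f \<in> A" "f \<noteq> 0"
  obtains k i e where "k \<ge> 1" "e \<in> A" "f * e = (z ^ (p ^ k) - z) ^ (p ^ i)"
proof -
  obtain i j e where ij: "i < j" "e \<in> A" "z ^ (p ^ j) - z ^ (p ^ i) = f * e"
    using pigeonhole_mod_principal[OF assms, of "\<lambda>n. z ^ (p ^ n)"] A_power[OF A_x_y_z(3)] by blast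
  have "(z ^ (p ^ (j - i)) - z) ^ (p ^ i) = z ^ (p ^ (j - i + i)) - z ^ (p ^ i)"
    by (simp add: frobenius_diff power_add flip: power_mult)
  with ij show thesis by (intro that[of "j - i" e i]) auto
qed

text \<open>
  The denominators of \<open>h\<close> form a proper ideal of \<open>A\<close>. A maximal ideal \<open>\<mm>\<close> above it contains some
  \<open>\<theta> = z\<^bsup>p\<^sup>k\<^esup> - z\<close>, which is a local parameter there, and the resulting place sees a pole of \<open>h\<close>.
\<close>

lemma place_of_pole_exists:
  assumes "h \<notin> A"
  obtains w where "is_place K w" "\<And>f. f \<in> A \<Longrightarrow> 0 \<le> w f" "w h < 0"
proof -
  define I where "I = {f \<in> A. f * h \<in> A}"
  obtain \<mm> where m: "I \<subseteq> \<mm>" "\<mm> \<subseteq> A" "1 \<notin> \<mm>" "\<And>f g. f \<in> \<mm> \<Longrightarrow> g \<in> \<mm> \<Longrightarrow> f + g \<in> \<mm>"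
    "\<And>f g. f \<in> A \<Longrightarrow> g \<in> \<mm> \<Longrightarrow> f * g \<in> \<mm>"
    "\<And>f g. f \<in> A \<Longrightarrow> g \<in> A \<Longrightarrow> f * g \<in> \<mm> \<Longrightarrow> f \<in> \<mm> \<or> g \<in> \<mm>"
  proof (rule maximal_ideal_exists[of A I])
    show "0 \<in> I" "1 \<notin> I" using assms A_0 by (auto simp: I_def)
    show "f + g \<in> I" if "f \<in> I" "g \<in> I" for f g using that by (auto simp: I_def A_add distrib_right)
    show "f * g \<in> I" if "f \<in> A" "g \<in> I" for f g using that by (auto simp: I_def A_mult mult.assoc)
  qed (auto simp: I_def A_1 A_add A_mult)
  have prime_power: "f \<in> \<mm>" if "f \<in> A" "f ^ n \<in> \<mm>" for f n
    using that
  proof (induction n)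
    case (Suc n)
    then have "f * f ^ n \<in> \<mm>" by simp
    from m(6)[OF Suc.prems(1) A_power[OF Suc.prems(1)] this] Suc show ?case by blast
  qed (use m in simp)
  obtain f g where fg: "f \<in> A" "g \<in> A" "g \<noteq> 0" "h = f / g" using fraction_of_A .
  then have "g \<in> \<mm>" using m(1) by (auto simp: I_def)
  obtain k i e where k: "k \<ge> 1" "e \<in> A" "g * e = (z ^ (p ^ k) - z) ^ (p ^ i)"
    using divides_separable_power[OF fg(2,3)] .
  define \<theta> where "\<theta> = z ^ (p ^ k) - z"
  have \<theta>: "\<theta> \<in> A" "\<theta> \<noteq> 0" using separable_param[OF k(1)] by (auto simp: \<theta>_def)
  have "e * g \<in> \<mm>" using m(5) k(2) \<open>g \<in> \<mm>\<close> by blast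
  then have "\<theta> \<in> \<mm>" using k(3) prime_power[OF \<theta>(1)] by (simp add: \<theta>_def mult.commute)
  have divides: "\<exists>s\<in>A - \<mm>. \<exists>e\<in>A. s * f = \<eta> * e" if f: "f \<in> \<mm>" and \<eta>: "\<eta> = z ^ (p ^ l) - z" "l \<ge> 1" for f \<eta> l
  proof -
    have "f \<in> A" using f m by auto
    then obtain j e where j: "j \<ge> 1" "e \<in> A" "f ^ (p ^ j) - f = \<eta> * e"
      using A_frobenius_periodic[OF \<eta>(2)] unfolding \<eta>(1) frobenius_periodic_def cong_mod_def by blast
    have "p ^ 0 < p ^ j" using prime_gt_1_nat[OF prime_p] j by (intro power_strict_increasing) auto
    then have "p ^ j = Suc (Suc (p ^ j - 2))" by simp
    then obtain n where n: "p ^ j = Suc (Suc n)" ..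
    \<comment> \<open>Modulo \<open>\<eta>\<close> the power \<open>f\<^bsup>p\<^sup>j - 1\<^esup>\<close> acts on \<open>f\<close> as 1, so its complement is the desired unit at \<open>\<mm>\<close>.\<close>
    have "(1 - f ^ Suc n) * f = f - f ^ (p ^ j)" unfolding n by (simp add: algebra_simps)
    also have "\<dots> = \<eta> * (- e)" using j(3) by (simp add: algebra_simps)
    finally have 1: "(1 - f ^ Suc n) * f = \<eta> * (- e)" .
    have pm: "f ^ Suc n \<in> \<mm>" using m(5)[OF A_power[OF \<open>f \<in> A\<close>, of n] f] by (simp add: mult.commute)
    have "1 - f ^ Suc n \<notin> \<mm>"
    proof
      assume "1 - f ^ Suc n \<in> \<mm>"
      from m(4)[OF this pm] m(3) show False by simp
    qed
    moreover have "1 - f ^ Suc n \<in> A" using \<open>f \<in> A\<close> by (intro A_diff A_1 A_power)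
    ultimately have "1 - f ^ Suc n \<in> A - \<mm>" by (rule DiffI[rotated])
    with 1 A_minus[OF j(2)] show ?thesis by (intro bexI)
  qed
  have bounded: "\<exists>N. \<forall>n. (\<exists>s\<in>A - \<mm>. \<exists>e\<in>A. s * f = \<theta> ^ n * e) \<longrightarrow> n < N" if f: "f \<in> A" "f \<noteq> 0" for f
  proof -
    obtain l j d where l: "l \<ge> 1" "d \<in> A" "f * d = (z ^ (p ^ l) - z) ^ (p ^ j)"
      using divides_separable_power[OF f] .
    define D P where "D = z ^ (p ^ l) - z" and "P = p ^ j"
    have D: "D \<in> A" "D \<noteq> 0" using separable_param[OF l(1)] by (auto simp: D_def)
    \<comment> \<open>Since \<open>f\<close> divides \<open>D\<^sup>P\<close> and, at \<open>\<mm>\<close>, the element \<open>D\<close> is either a unit or a divisor of \<open>\<theta>\<close>,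
      the order of \<open>f\<close> at \<open>\<theta>\<close> is at most \<open>P\<close>.\<close>
    have "\<not> (\<exists>s\<in>A - \<mm>. \<exists>e\<in>A. s * f = \<theta> ^ n * e)" if n: "n > P" for n
    proof
      assume "\<exists>s\<in>A - \<mm>. \<exists>e\<in>A. s * f = \<theta> ^ n * e"
      then obtain s e where s: "s \<in> A" "s \<notin> \<mm>" "e \<in> A" "s * f = \<theta> ^ n * e" by blast
      have sD: "s * D ^ P = \<theta> ^ n * (e * d)"
        using s(4) l(3) by (simp add: D_def P_def mult_ac flip: mult.assoc) (metis mult.assoc mult.commute)
      have "D \<in> \<mm>"
      proof -
        have "\<theta> ^ n \<in> \<mm>"
          using n m(5)[OF A_power[OF \<theta>(1), of "n - 1"] \<open>\<theta> \<in> \<mm>\<close>] by (cases n) (auto simp: mult.commute)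
        then have "(e * d) * \<theta> ^ n \<in> \<mm>" using m(5) s l A_mult by blast
        then have "s * D ^ P \<in> \<mm>" using sD by (simp add: mult.commute)
        then show ?thesis using m(6)[OF s(1) A_power[OF D(1)]] s(2) prime_power[OF D(1)] by blast
      qed
      obtain s' e' where s': "s' \<in> A" "s' \<notin> \<mm>" "e' \<in> A" "s' * \<theta> = D * e'"
        using divides[OF \<open>\<theta> \<in> \<mm>\<close> D_def l(1)] by blast
      have "s' ^ n * (s * D ^ P) = (s' * \<theta>) ^ n * (e * d)"
        unfolding sD by (simp add: power_mult_distrib mult_ac)
      also have "\<dots> = D ^ n * (e' ^ n * (e * d))" unfolding s'(4) by (simp add: power_mult_distrib mult_ac)
      also have "D ^ n = D ^ P * (D * D ^ (n - P - 1))"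
        using n by (simp flip: power_add power_Suc)
      finally have "D ^ P * (s' ^ n * s) = D ^ P * ((D ^ (n - P - 1) * (e' ^ n * (e * d))) * D)"
        by (simp only: mult_ac)
      then have "s' ^ n * s = (D ^ (n - P - 1) * (e' ^ n * (e * d))) * D" using D(2) by simp
      also have "\<dots> \<in> \<mm>" using D s s' l \<open>D \<in> \<mm>\<close> by (intro m(5) A_mult A_power)
      finally show False using m(6)[OF A_power[OF s'(1)] s(1)] s(2) s'(2) prime_power[OF s'(1)] by blast
    qed
    then show ?thesis by (intro exI[of _ "Suc P"] allI impI) (meson not_less_eq)
  qed
  interpret local_parameter K A \<mm> \<theta>
  proof unfold_locales
    show "\<exists>f\<in>A. \<exists>g\<in>A. g \<noteq> 0 \<and> h = f / g" for h using fraction_of_A by metis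
    show "\<exists>s\<in>A - \<mm>. \<exists>e\<in>A. s * f = \<theta> * e" if "f \<in> \<mm>" for f using divides[OF that \<theta>_def k(1)] .
    show "\<exists>N. \<forall>n. (\<exists>s\<in>A - \<mm>. \<exists>e\<in>A. s * f = \<theta> ^ n * e) \<longrightarrow> n < N" if "f \<in> A" "f \<noteq> 0" for f
      using bounded[OF that] .
  qed (use K_subset_A A_add A_mult m \<theta> \<open>\<theta> \<in> \<mm>\<close> in auto)
  have "\<not> 0 \<le> order_at h"
  proof
    assume "0 \<le> order_at h"
    from denominator_of_regular[OF this] m(1) show False by (auto simp: I_def)
  qed
  with place_order_at order_at_R show thesis by (intro that[of order_at]) auto
qed

text \<open>
  The affine ring is integrally closed: a function outside \<open>A\<close> has a pole at a place where \<open>x\<close> is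
  regular.
\<close>

lemma regular_away_from_inf_in_A:
  assumes "\<And>w. is_place K w \<Longrightarrow> w \<noteq> Pinf \<Longrightarrow> regular_at w h"
  shows "h \<in> A"
proof (rule ccontr)
  assume "h \<notin> A"
  then obtain w where w: "is_place K w" "\<And>f. f \<in> A \<Longrightarrow> 0 \<le> w f" "w h < 0"
    using place_of_pole_exists by blast
  have "w \<noteq> Pinf" using w(2)[OF A_x_y_z(1)] pole_x by auto
  from assms[OF w(1) this] w(3) w(1) show False by (auto simp: regular_at_def is_place_def)
qed

end

section \<open>Functions with poles at the chosen points\<close>

locale pointed_curve = projective_curve K p a b q r M c x y z Pinf
  for K :: "'f::field set" and p a b q r M c x y z Pinf +
  fixes m :: nat and \<alpha> :: "nat \<Rightarrow> 'f" and P :: "nat \<Rightarrow> 'f \<Rightarrow> int"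
  assumes m_pos: "m \<ge> 1" and inj_\<alpha>: "inj_on \<alpha> {1..m}"
    and \<alpha>_in_K: "\<And>i. i \<in> {1..m} \<Longrightarrow> \<alpha> i \<in> K"
    and \<alpha>_root: "\<And>i. i \<in> {1..m} \<Longrightarrow> tpoly p a b (\<alpha> i) = 0"
    and P_place: "\<And>i. i \<in> {1..m} \<Longrightarrow> is_place K (P i)"
    and P_zero: "\<And>i. i \<in> {1..m} \<Longrightarrow> 0 < P i (x - \<alpha> i)"
begin

lemma graded_P: assumes "i \<in> {1..m}" shows "graded_by (P i) 1 (term_order_at (\<alpha> i))"
proof -
  have "graded_by (P i) (P i z) (term_order_at (\<alpha> i))"
    using assms by (intro graded_at P_place P_zero \<alpha>_in_K \<alpha>_root)
  with graded_unique(2)[OF this this separating_at] show ?thesis by simp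
qed

lemma place_over_root_eq:
  assumes "is_place K w" "i \<in> {1..m}" "0 < w (x - \<alpha> i)"
  shows "w = P i"
  using graded_unique(1)[OF graded_at[OF assms(1,3)] graded_P[OF assms(2)] separating_at]
    \<alpha>_in_K \<alpha>_root assms(2) by simp

lemma linear_nonzero: "i \<in> {1..m} \<Longrightarrow> x - \<alpha> i \<noteq> 0"
  using x_minus_const_nonzero \<alpha>_in_K by blast

lemma Pinf_linear: assumes "i \<in> {1..m}" shows "Pinf (x - \<alpha> i) = - (int (q + 1) * int M)"
  using Pinf_term[of "[:- \<alpha> i, 1:]" 0 0] \<alpha>_in_K[OF assms]
  by (simp add: polys_pCons polys_0 K_closed term_order_inf_def)

lemma P_linear:
  assumes "i \<in> {1..m}" "j \<in> {1..m}"
  shows "P i (x - \<alpha> j) = (if i = j then int (q + 1) * int M else 0)"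
proof -
  interpret place_over K "P i" by unfold_locales (use is_subfield P_place assms in auto)
  show ?thesis
  proof (cases "i = j")
    case True
    have "P i z = 1" using graded_byD[OF graded_P[OF assms(1)] polys_1, of 0 1]
      by (simp add: term_order_at_def)
    moreover have "P i (x - \<alpha> i) = P i z * (int (q + 1) * int M)"
      by (rule orders_at_root_of_t(1)[OF P_place[OF assms(1)] P_zero[OF assms(1)]
            \<alpha>_in_K[OF assms(1)] \<alpha>_root[OF assms(1)]])
    ultimately show ?thesis using True by simp
  next
    case False
    then have ne: "\<alpha> i - \<alpha> j \<noteq> 0" using inj_\<alpha> assms by (auto dest: inj_onD)
    have v0: "P i (\<alpha> i - \<alpha> j) = 0" using \<alpha>_in_K assms by (intro val_const K_diff)
    then have "ord_ge (P i) (P i (\<alpha> i - \<alpha> j) + 1) (x - \<alpha> i)"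
      using P_zero[OF assms(1)] by (simp add: ord_ge_def)
    from add_dominant[OF ne this] v0 False show ?thesis by simp
  qed
qed

definition points :: "('f \<Rightarrow> int) set" where
  "points = insert Pinf (P ` {1..m})"

definition regular_outside :: "'f \<Rightarrow> bool" where
  "regular_outside h \<longleftrightarrow> (\<forall>w. is_place K w \<and> w \<notin> points \<longrightarrow> regular_at w h)"

text \<open>
  These are the orders of \<open>g(x) y\<^sup>d z\<^sup>f\<close> if the rational function \<open>g\<close> has degree \<open>E\<close> and order
  \<open>ords k\<close> at each \<open>\<alpha>\<^sub>k\<close>. The points only see \<open>g\<close> through these numbers, and the one relation
  between them is \<open>\<Sum>k. ords k \<le> E\<close>, with equality if \<open>g\<close> is a product of powers of the \<open>x - \<alpha>\<^sub>k\<close>.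
\<close>

definition has_profile :: "'f \<Rightarrow> nat \<Rightarrow> nat \<Rightarrow> (nat \<Rightarrow> int) \<Rightarrow> int \<Rightarrow> bool" where
  "has_profile u d f ords E \<longleftrightarrow> u \<noteq> 0 \<and> regular_outside u \<and>
     Pinf u = - (int (q + 1) * int M * E + int d * (int r * int M) + int f * (int r * int q ^ 2)) \<and>
     (\<forall>i\<in>{1..m}. P i u = int (q + 1) * int M * ords i + int d * int M + int f)"

lemma other_place:
  assumes "is_place K w" "w \<notin> points"
  shows "f \<in> A \<Longrightarrow> ord_ge w 0 f" and "i \<in> {1..m} \<Longrightarrow> w (x - \<alpha> i) = 0"
proof -
  have "\<not> w x < 0" using place_with_pole_of_x_eq assms by (auto simp: points_def)
  then show A: "ord_ge w 0 f" if "f \<in> A" for f using affine_place_nonneg assms(1) that by simp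
  assume i: "i \<in> {1..m}"
  have "\<not> 0 < w (x - \<alpha> i)" using place_over_root_eq[OF assms(1) i] i assms(2) by (auto simp: points_def)
  moreover have "x - \<alpha> i \<in> A" using A_x_y_z \<alpha>_in_K[OF i] K_subset_A by (intro A_diff) auto
  ultimately show "w (x - \<alpha> i) = 0" using A linear_nonzero[OF i] by (force simp: ord_ge_def)
qed

text \<open>
  The factor in front only changes \<open>g\<close>: it is the product of the powers \<open>(x - \<alpha>\<^sub>i)\<^bsup>e i\<^esup>\<close>, which is
  supported at the chosen points.
\<close>

lemma profile_exists:
  assumes g: "g \<in> polys_over K" "g \<noteq> 0"
  shows "has_profile ((\<Prod>i=1..m. (x - \<alpha> i) powi e i) * (poly g x * y ^ d * z ^ f)) d f
    (\<lambda>i. e i + int (order (\<alpha> i) g)) ((\<Sum>i=1..m. e i) + int (degree g))"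
proof -
  define t where "t = poly g x * y ^ d * z ^ f"
  define D where "D = (\<Prod>i=1..m. (x - \<alpha> i) powi e i)"
  have t: "t \<noteq> 0" using poly_x_nonzero[OF g] y_nonzero z_nonzero by (simp add: t_def)
  have D: "D \<noteq> 0" using linear_nonzero by (simp add: D_def)
  have vD: "w D = (\<Sum>i=1..m. e i * w (x - \<alpha> i))" if "is_place K w" for w
  proof -
    interpret place_over K w by unfold_locales (use is_subfield that in auto)
    have "w D = (\<Sum>i=1..m. w ((x - \<alpha> i) powi e i))"
      unfolding D_def using linear_nonzero by (intro val_prod) auto
    also have "\<dots> = (\<Sum>i=1..m. e i * w (x - \<alpha> i))"
      using linear_nonzero by (intro sum.cong val_power_int) auto
    finally show ?thesis .
  qed
  have mult: "w (D * t) = (\<Sum>i=1..m. e i * w (x - \<alpha> i)) + w t" if "is_place K w" for w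
    using that vD[OF that] D t by (simp add: is_place_def)
  have "regular_at w (D * t)" if w: "is_place K w" "w \<notin> points" for w
  proof -
    have "t \<in> A" unfolding t_def using A_x_y_z A_poly_mult[OF g(1) A_1] by (intro A_mult A_power) auto
    from other_place(1)[OF w this] t have "0 \<le> w t" by (simp add: ord_ge_def)
    then show ?thesis using mult[OF w(1)] other_place(2)[OF w] by (simp add: regular_at_def)
  qed
  then have "regular_outside (D * t)" by (simp add: regular_outside_def)
  moreover have "Pinf (D * t) = (\<Sum>i=1..m. e i * (- (int (q + 1) * int M))) + term_order_inf g d f"
    using mult[OF inf.place] Pinf_linear Pinf_term[OF g] by (simp add: t_def)
  then have "Pinf (D * t) = - (int (q + 1) * int M * ((\<Sum>i=1..m. e i) + int (degree g))
      + int d * (int r * int M) + int f * (int r * int q ^ 2))"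
    unfolding term_order_inf_def sum_distrib_right[symmetric] by (simp add: algebra_simps)
  moreover have "P i (D * t) = int (q + 1) * int M * (e i + int (order (\<alpha> i) g)) + int d * int M + int f"
    if i: "i \<in> {1..m}" for i
  proof -
    have "(\<Sum>k=1..m. e k * P i (x - \<alpha> k)) = (\<Sum>k=1..m. if i = k then e i * (int (q + 1) * int M) else 0)"
      using P_linear[OF i] by (intro sum.cong) auto
    also have "\<dots> = e i * (int (q + 1) * int M)" using i by simp
    finally have s: "(\<Sum>k=1..m. e k * P i (x - \<alpha> k)) = e i * (int (q + 1) * int M)" .
    have "P i t = term_order_at (\<alpha> i) g d f" using graded_P[OF i] g by (simp add: graded_by_def t_def)
    then show ?thesis using mult[OF P_place[OF i]] s by (simp add: term_order_at_def algebra_simps)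
  qed
  ultimately show ?thesis unfolding has_profile_def t_def[symmetric] D_def[symmetric] using D t by simp
qed

lemma monomial_profile:
  obtains u where "has_profile u d f e (\<Sum>i=1..m. e i)"
  using profile_exists[OF polys_1, of e d f] by simp

lemma sum_orders_le_degree:
  assumes "g \<noteq> 0"
  shows "(\<Sum>i=1..m. order (\<alpha> i) g) \<le> degree g"
proof -
  have "(\<Sum>i=1..m. order (\<alpha> i) g) = (\<Sum>u\<in>\<alpha> ` {1..m}. order u g)"
    by (subst sum.reindex[OF inj_\<alpha>]) (simp add: comp_def)
  also have "\<dots> = (\<Sum>u\<in>\<alpha> ` {1..m} \<inter> {u. poly g u = 0}. order u g)"
    by (rule sum.mono_neutral_right) (auto simp: order_0I)
  also have "\<dots> \<le> (\<Sum>u | poly g u = 0. order u g)"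
    by (rule sum_mono2) (auto simp: poly_roots_finite assms)
  also have "\<dots> \<le> degree g" using sum_order_le_degree[OF assms] .
  finally show ?thesis .
qed

text \<open>
  Since \<open>x - \<alpha>\<^sub>i\<close> vanishes at \<open>P\<^sub>i\<close> and nowhere else, a high power of the product of these functions
  removes all poles except the one at infinity.
\<close>

lemma clear_poles:
  assumes "regular_outside h" "h \<noteq> 0"
  obtains N where "(\<Prod>i=1..m. (x - \<alpha> i) powi int N) * h \<in> A"
proof -
  define N where "N = nat (\<Sum>i=1..m. \<bar>P i h\<bar>)"
  define D where "D = (\<Prod>i=1..m. (x - \<alpha> i) powi int N)"
  have D: "has_profile D 0 0 (\<lambda>i. int N) (\<Sum>i=1..m. int N)"
    using profile_exists[OF polys_1, of "\<lambda>i. int N" 0 0] by (simp add: D_def)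
  have "regular_at w (D * h)" if w: "is_place K w" "w \<noteq> Pinf" for w
  proof (cases "w \<in> points")
    case True
    then obtain i where i: "i \<in> {1..m}" "w = P i" using w by (auto simp: points_def)
    have "\<bar>P i h\<bar> \<le> (\<Sum>i=1..m. \<bar>P i h\<bar>)" using i by (intro member_le_sum) auto
    then have "- P i h \<le> int N" by (simp add: N_def)
    also have "int N \<le> int (q + 1) * int M * int N"
    proof -
      have "1 * N \<le> (q + 1) * M * N" using M_pos by (intro mult_right_mono) auto
      then have "int (1 * N) \<le> int ((q + 1) * M * N)" by (simp only: of_nat_le_iff)
      then show ?thesis by (simp only: of_nat_mult mult_1)
    qed
    also have "\<dots> = P i D" using D i(1) by (simp add: has_profile_def)
    finally have "0 \<le> P i D + P i h" by simp
    then show ?thesis using w(1) D assms(2) by (simp add: i(2) regular_at_def is_place_def has_profile_def)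
  next
    case False
    then have "regular_at w D" "regular_at w h"
      using w D assms(1) by (auto simp: has_profile_def regular_outside_def)
    moreover have "D \<noteq> 0" using D by (simp add: has_profile_def)
    then have "w (D * h) = w D + w h" using w(1) assms(2) by (simp add: is_place_def)
    ultimately show ?thesis using assms(2) by (auto simp: regular_at_def)
  qed
  then have "D * h \<in> A" by (rule regular_away_from_inf_in_A)
  with that show thesis by (simp add: D_def)
qed

text \<open>
  Expand \<open>h\<close>, after clearing its poles, in the basis \<open>y\<^sup>d z\<^sup>f\<close>. At each of the points the components
  have different orders, so no component has a smaller order than \<open>h\<close> anywhere, and at a prescribed
  point \<open>v\<close> some component attains the order of \<open>h\<close>. This reduces all questions about the semigroup
  to single monomials.
\<close>

lemma extremal_component:
  assumes h: "regular_outside h" "h \<noteq> 0" and v: "v \<in> points"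
  obtains u d f ords E where "(d, f) \<in> exps" "has_profile u d f ords E" "(\<Sum>i=1..m. ords i) \<le> E"
    "v u = v h" "\<forall>w\<in>points. w h \<le> w u"
proof -
  obtain N where N: "(\<Prod>i=1..m. (x - \<alpha> i) powi int N) * h \<in> A" using clear_poles[OF h] .
  define D where "D = (\<Prod>i=1..m. (x - \<alpha> i) powi int N)"
  define D' where "D' = (\<Prod>i=1..m. (x - \<alpha> i) powi - int N)"
  have D: "D \<noteq> 0" using linear_nonzero by (simp add: D_def)
  have DD: "D' = inverse D"
    unfolding D_def D'_def by (simp add: power_int_minus prod_inversef[symmetric])
  obtain G where G: "\<And>d e. G d e \<in> polys_over K"
    "D * h = (\<Sum>(d, e)\<in>exps. poly (G d e) x * y ^ d * z ^ e)"
    using N by (auto simp: coord_ring_def D_def)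
  define t where "t d f = poly (G d f) x * y ^ d * z ^ f" for d f
  have ne: "D * h \<noteq> 0" using D h by simp
  have t_ne: "t d f \<noteq> 0" if "G d f \<noteq> 0" for d f
    using poly_x_nonzero[OF G(1) that] y_nonzero z_nonzero by (simp add: t_def)
  have graded: "\<exists>W. graded_by w 1 W \<and> separating W" if "w \<in> points" for w
    using that graded_Pinf separating_inf graded_P separating_at unfolding points_def by blast
  \<comment> \<open>The same coefficients \<open>G\<close> serve all points at once, so the component found at \<open>v\<close> can be
    compared with \<open>h\<close> at the other points.\<close>
  have min: "\<exists>(d, f)\<in>exps. G d f \<noteq> 0 \<and> w (D * h) = w (t d f) \<and>
      (\<forall>(d', f')\<in>exps. G d' f' \<noteq> 0 \<longrightarrow> w (D * h) \<le> w (t d' f'))" if w: "w \<in> points" for w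
  proof -
    obtain W where W: "graded_by w 1 W" "separating W" using graded[OF w] by blast
    have wt: "w (t d f) = W (G d f) d f" if "G d f \<noteq> 0" for d f
      using W(1) G(1) that by (simp add: graded_by_def t_def)
    obtain d f where "(d, f) \<in> exps" "G d f \<noteq> 0" "w (D * h) = 1 * W (G d f) d f"
      "\<And>d' f'. (d', f') \<in> exps \<Longrightarrow> G d' f' \<noteq> 0 \<Longrightarrow> W (G d f) d f \<le> W (G d' f') d' f'"
      using order_of_normal_form[OF W G ne] by metis
    then show ?thesis using wt by (intro bexI[of _ "(d, f)"]) auto
  qed
  have split: "w (D * h) = w D + w h" "G d f \<noteq> 0 \<Longrightarrow> w (D' * t d f) = w (t d f) - w D" if "w \<in> points" for w d f
  proof -
    interpret place_over K w
      by unfold_locales (use is_subfield that inf.place P_place in \<open>auto simp: points_def\<close>)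
    show "w (D * h) = w D + w h" using D h by (simp add: val_mult)
    show "w (D' * t d f) = w (t d f) - w D" if "G d f \<noteq> 0"
      unfolding DD using D t_ne[OF that] by (simp add: val_mult val_inverse)
  qed
  obtain d f where df: "(d, f) \<in> exps" "G d f \<noteq> 0" "v (D * h) = v (t d f)" using min[OF v] by blast
  show thesis
  proof (rule that[OF df(1)])
    show "has_profile (D' * t d f) d f (\<lambda>i. - int N + int (order (\<alpha> i) (G d f)))
        ((\<Sum>i=1..m. - int N) + int (degree (G d f)))"
      unfolding D'_def t_def by (rule profile_exists[OF G(1) df(2)])
    show "(\<Sum>i=1..m. - int N + int (order (\<alpha> i) (G d f))) \<le> (\<Sum>i=1..m. - int N) + int (degree (G d f))"
      using sum_orders_le_degree[OF df(2)] by (simp only: sum.distrib add_le_cancel_left of_nat_le_iff flip: of_nat_sum)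
    show "v (D' * t d f) = v h" using split[OF v] df by simp
    show "\<forall>w\<in>points. w h \<le> w (D' * t d f)"
    proof
      fix w assume w: "w \<in> points"
      show "w h \<le> w (D' * t d f)" using min[OF w] split[OF w] df(1,2) by fastforce
    qed
  qed
qed

section \<open>Absolute maximal elements are the pole orders of monomials\<close>

definition Qs :: "('f \<Rightarrow> int) list" where
  "Qs = Pinf # map P [1..<m + 1]"

lemma length_Qs: "length Qs = m + 1"
  by (simp add: Qs_def)

lemma set_Qs: "set Qs = points"
  by (auto simp: Qs_def points_def)

lemma Qs_0: "Qs ! 0 = Pinf"
  by (simp add: Qs_def)

lemma Qs_nth: "i \<in> {1..m} \<Longrightarrow> Qs ! i = P i"
  by (auto simp: Qs_def nth_Cons' simp del: upt_Suc)

lemma Qs_in_points: "i < m + 1 \<Longrightarrow> Qs ! i \<in> points"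
  using length_Qs set_Qs nth_mem by metis

definition pole_orders :: "'f \<Rightarrow> int list" where
  "pole_orders h = map (\<lambda>v. - v h) Qs"

lemma pole_orders_nth: "i < m + 1 \<Longrightarrow> pole_orders h ! i = - (Qs ! i) h"
  by (simp add: pole_orders_def length_Qs)

lemma semigroup_eq:
  "gen_weierstrass_semigroup K Qs = {pole_orders h | h. h \<noteq> 0 \<and> regular_outside h}"
  by (simp add: gen_weierstrass_semigroup_def pole_orders_def regular_outside_def set_Qs)

lemma nabla_pole_orders_empty_iff:
  "nabla K Qs J (pole_orders h) = {} \<longleftrightarrow>
     (\<forall>h'. h' \<noteq> 0 \<longrightarrow> regular_outside h' \<longrightarrow>
       (\<forall>j\<in>J. (Qs ! j) h' = (Qs ! j) h) \<longrightarrow> (\<exists>i\<in>{..<m + 1} - J. (Qs ! i) h' \<le> (Qs ! i) h))"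
  if "J \<subseteq> {..<m + 1}"
proof -
  have "(\<forall>j\<in>J. pole_orders h' ! j = pole_orders h ! j) \<longleftrightarrow> (\<forall>j\<in>J. (Qs ! j) h' = (Qs ! j) h)" for h'
    using that by (intro ball_cong) (auto simp: pole_orders_nth subset_iff)
  moreover have "(\<forall>i\<in>{..<length Qs} - J. pole_orders h' ! i < pole_orders h ! i)
      \<longleftrightarrow> \<not> (\<exists>i\<in>{..<m + 1} - J. (Qs ! i) h' \<le> (Qs ! i) h)" for h'
    by (auto simp: pole_orders_nth length_Qs not_le)
  ultimately show ?thesis using that unfolding nabla_def semigroup_eq by blast
qed

text \<open>
  Let \<open>h\<close> be as in the definition of \<open>\<nabla>\<^sub>J\<close>. The component of \<open>h\<close> that attains its order at a point
  of \<open>J\<close> has the same residue there as \<open>u\<close>, hence the same exponents \<open>d\<close> and \<open>f\<close>. Its remaining orders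
  are at least those of \<open>u\<close>, while its degree is at most \<open>\<Sum>i. e i\<close>; as the sum of its orders is bounded
  by its degree, the component has the orders of \<open>u\<close> at all points. These bound the orders of
  \<open>h\<close>, which therefore cannot be larger outside \<open>J\<close>.
\<close>

lemma monomial_absolute_maximal:
  assumes df: "(d, f) \<in> exps" and u: "has_profile u d f e (\<Sum>i=1..m. e i)"
  shows "pole_orders u \<in> absolute_maximal_elements K Qs"
proof -
  have "nabla K Qs J (pole_orders u) = {}" if J: "J \<noteq> {}" "J \<subset> {..<m + 1}" for J
  proof (subst nabla_pole_orders_empty_iff)
    show "J \<subseteq> {..<m + 1}" using J by auto
    show "\<forall>h. h \<noteq> 0 \<longrightarrow> regular_outside h \<longrightarrow>
      (\<forall>j\<in>J. (Qs ! j) h = (Qs ! j) u) \<longrightarrow> (\<exists>i\<in>{..<m + 1} - J. (Qs ! i) h \<le> (Qs ! i) u)"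
    proof (intro allI impI, rule ccontr)
      fix h assume h: "h \<noteq> 0" "regular_outside h" and eq: "\<forall>j\<in>J. (Qs ! j) h = (Qs ! j) u"
        and less: "\<not> (\<exists>i\<in>{..<m + 1} - J. (Qs ! i) h \<le> (Qs ! i) u)"
      have ge: "(Qs ! i) u \<le> (Qs ! i) h" if "i < m + 1" for i
      proof (cases "i \<in> J")
        case False
        with that less have "\<not> (Qs ! i) h \<le> (Qs ! i) u" by blast
        then show ?thesis by simp
      qed (simp add: eq)
      obtain j where j: "j \<in> J" "j < m + 1" using J by auto
      obtain u' d' f' e' E where u': "(d', f') \<in> exps" "has_profile u' d' f' e' E"
        "(\<Sum>i=1..m. e' i) \<le> E" "(Qs ! j) u' = (Qs ! j) h" "\<forall>w\<in>points. w h \<le> w u'"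
        using extremal_component[OF h(2,1) Qs_in_points[OF j(2)]] by metis
      have j_eq: "(Qs ! j) u' = (Qs ! j) u" using u'(4) eq j(1) by simp
      have "d' = d \<and> f' = f"
      proof (cases "j = 0")
        case True
        then show ?thesis using j_eq u u'(2) Qs_0 unfolding has_profile_def neg_equal_iff_equal
          by (intro inf_residues_distinct[OF u'(1) df, of E "\<Sum>i=1..m. e i"]) simp
      next
        case False
        then have "j \<in> {1..m}" using j(2) by auto
        then show ?thesis using j_eq u u'(2) Qs_nth unfolding has_profile_def
          by (intro root_residues_distinct[OF u'(1) df, of "e' j" "e j"]) simp
      qed
      then have df': "d' = d" "f' = f" by auto
      have T: "0 < int (q + 1) * int M" using M_pos by simp
      have le: "(Qs ! i) u \<le> (Qs ! i) u'" if "i < m + 1" for i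
        using ge[OF that] bspec[OF u'(5) Qs_in_points[OF that]] by simp
      have "e i \<le> e' i" if "i \<in> {1..m}" for i
      proof -
        have "int (q + 1) * int M * e i \<le> int (q + 1) * int M * e' i"
          using le[of i] that Qs_nth[OF that] u u'(2) df' by (simp add: has_profile_def)
        with T show ?thesis by (simp only: mult_le_cancel_left_pos)
      qed
      moreover from this have "(\<Sum>i=1..m. e i) \<le> (\<Sum>i=1..m. e' i)" by (rule sum_mono)
      moreover have "int (q + 1) * int M * E \<le> int (q + 1) * int M * (\<Sum>i=1..m. e i)"
        using le[of 0] Qs_0 u u'(2) df' by (simp add: has_profile_def)
      then have "E \<le> (\<Sum>i=1..m. e i)" using T by (simp only: mult_le_cancel_left_pos)
      ultimately have E: "E = (\<Sum>i=1..m. e i)" "(\<Sum>i=1..m. e i) = (\<Sum>i=1..m. e' i)"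
        and e_le: "\<And>i. i \<in> {1..m} \<Longrightarrow> e i \<le> e' i" using u'(3) by auto
      have e_eq: "e i = e' i" if "i \<in> {1..m}" for i
        using sum_mono_inv[OF E(2) e_le that] by simp
      have "(Qs ! i) u' = (Qs ! i) u" if "i < m + 1" for i
      proof (cases "i = 0")
        case True
        then show ?thesis using u u'(2) Qs_0 df' E(1) by (simp add: has_profile_def)
      next
        case False
        with that have "i \<in> {1..m}" by auto
        then show ?thesis using u u'(2) Qs_nth df' e_eq by (simp add: has_profile_def)
      qed
      moreover obtain i where "i < m + 1" "i \<notin> J" using J(2) by auto
      ultimately show False using bspec[OF u'(5) Qs_in_points] less by force
    qed
  qed
  moreover have "pole_orders u \<in> gen_weierstrass_semigroup K Qs"
    using u by (auto simp: semigroup_eq has_profile_def)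
  ultimately show ?thesis by (auto simp: absolute_maximal_elements_def length_Qs)
qed

text \<open>
  Conversely, let \<open>u\<close> be the component of \<open>h\<close> that attains its order at infinity. If it had larger order
  than \<open>h\<close> at some point, then \<open>u\<close> would contradict maximality, with \<open>J\<close> the set of points where the
  orders agree. If its degree \<open>E\<close> exceeded the sum of its orders, then the monomial with the same
  orders at the \<open>P\<^sub>i\<close> would contradict maximality with \<open>J = {1..m}\<close>.
\<close>

lemma absolute_maximal_monomial:
  assumes "\<gamma> \<in> absolute_maximal_elements K Qs"
  obtains u d f e where "(d, f) \<in> exps" "has_profile u d f e (\<Sum>i=1..m. e i)" "\<gamma> = pole_orders u"
proof -
  obtain h where h: "h \<noteq> 0" "regular_outside h" "\<gamma> = pole_orders h"
    using assms by (auto simp: absolute_maximal_elements_def semigroup_eq)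
  have max: "\<exists>i\<in>{..<m + 1} - J. (Qs ! i) h' \<le> (Qs ! i) h"
    if "J \<noteq> {}" "J \<subset> {..<m + 1}" "h' \<noteq> 0" "regular_outside h'" "\<forall>j\<in>J. (Qs ! j) h' = (Qs ! j) h" for J h'
  proof -
    have "nabla K Qs J (pole_orders h) = {}"
      using assms that(1,2) by (simp add: absolute_maximal_elements_def length_Qs h(3))
    moreover have "J \<subseteq> {..<m + 1}" using that by auto
    ultimately show ?thesis using that nabla_pole_orders_empty_iff by blast
  qed
  have inf: "Pinf \<in> points" by (simp add: points_def)
  obtain u d f e E where u: "(d, f) \<in> exps" "has_profile u d f e E" "(\<Sum>i=1..m. e i) \<le> E"
    "Pinf u = Pinf h" "\<forall>w\<in>points. w h \<le> w u"
    by (rule extremal_component[OF h(2,1) inf]) (rule that)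
  define J where "J = {i \<in> {..<m + 1}. (Qs ! i) u = (Qs ! i) h}"
  have u_eq: "(Qs ! i) u = (Qs ! i) h" if "i < m + 1" for i
  proof (rule ccontr)
    assume "(Qs ! i) u \<noteq> (Qs ! i) h"
    then have sub: "J \<subset> {..<m + 1}" using that by (auto simp: J_def)
    have "0 \<in> J" using u(4) by (simp add: J_def Qs_0)
    then have ne: "J \<noteq> {}" by blast
    have u_reg: "u \<noteq> 0" "regular_outside u" using u(2) by (simp_all add: has_profile_def)
    have "\<forall>j\<in>J. (Qs ! j) u = (Qs ! j) h" by (simp add: J_def)
    from max[OF ne sub u_reg this] obtain k where k: "k < m + 1" "k \<notin> J" "(Qs ! k) u \<le> (Qs ! k) h"
      by blast
    with bspec[OF u(5) Qs_in_points[OF k(1)]] show False by (auto simp: J_def)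
  qed
  obtain u' where u': "has_profile u' d f e (\<Sum>i=1..m. e i)" using monomial_profile .
  have u'_eq: "(Qs ! i) u' = (Qs ! i) h" if "i \<in> {1..m}" for i
    using u' u(2) u_eq[of i] Qs_nth[OF that] that by (simp add: has_profile_def)
  have "{1..m} \<noteq> {}" using m_pos by simp
  moreover have "{1..m} \<subset> {..<m + 1}"
  proof
    show "{1..m} \<subseteq> {..<m + 1}" by auto
    have "(0::nat) \<in> {..<m + 1}" "(0::nat) \<notin> {1..m}" by simp_all
    then show "{1..m} \<noteq> {..<m + 1}" by metis
  qed
  moreover have "u' \<noteq> 0" "regular_outside u'" using u' by (simp_all add: has_profile_def)
  ultimately have "\<exists>i\<in>{..<m + 1} - {1..m}. (Qs ! i) u' \<le> (Qs ! i) h"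
    using u'_eq by (intro max ballI)
  moreover have "{..<m + 1} - {1..m} = {0}" by auto
  ultimately have "Pinf u' \<le> Pinf u" using u(4) by (simp add: Qs_0)
  then have "int (q + 1) * int M * E \<le> int (q + 1) * int M * (\<Sum>i=1..m. e i)"
    using u(2) u' by (simp add: has_profile_def)
  moreover have "0 < int (q + 1) * int M" using M_pos by simp
  ultimately have "E \<le> (\<Sum>i=1..m. e i)" by (simp only: mult_le_cancel_left_pos)
  with u(3) have "E = (\<Sum>i=1..m. e i)" by simp
  with u(2) have "has_profile u d f e (\<Sum>i=1..m. e i)" by simp
  moreover have "\<gamma> = pole_orders u"
    unfolding h(3) pole_orders_def using u_eq length_Qs by (simp add: list_eq_iff_nth_eq)
  ultimately show thesis using that u(1) by blast
qed

lemma profile_pole_orders: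
  assumes "has_profile u d f e E"
  shows "pole_orders u = (int (q + 1) * int M * E + int d * (int r * int M) + int f * (int r * int q ^ 2))
    # map (\<lambda>i. - (int (q + 1) * int M * e i + int d * int M + int f)) [1..<m + 1]"
  using assms unfolding pole_orders_def Qs_def
  by (auto simp: has_profile_def simp del: upt_Suc)

lemma q_eq: "q = p ^ b * r"
proof -
  have "b \<le> a" using b_dvd_a a_pos by (intro dvd_imp_le) auto
  then show ?thesis by (simp add: q_def r_def flip: power_add)
qed

lemma alpha_tuple_eq:
  "alpha_tuple p b q M m i j =
     ((int q * int r - int m) * (int (q + 1) * int M) - i * (int r * int M) - j * (int r * int q ^ 2))
     # replicate m (i * int M + j)"
proof -
  have "(int q ^ 2 - int m * int p ^ b) * (int q + 1) * int M - i * int q * int M - j * int q ^ 3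
    = int p ^ b * ((int q * int r - int m) * (int (q + 1) * int M) - i * (int r * int M) - j * (int r * int q ^ 2))"
  proof -
    have "int q = int p ^ b * int r" by (simp add: q_eq)
    then have "int q ^ 2 = int q * (int p ^ b * int r)" "int q ^ 3 = int p ^ b * int r * int q ^ 2"
      "i * int q * int M = i * (int p ^ b * int r) * int M"
      by (simp_all add: power2_eq_square power3_eq_cube)
    then show ?thesis by (simp only: of_nat_add of_nat_1) (simp add: algebra_simps)
  qed
  moreover have "int p ^ b \<noteq> 0" using prime_gt_0_nat[OF prime_p] by simp
  ultimately show ?thesis by (simp add: alpha_tuple_def)
qed

text \<open>
  Put \<open>T = (q + 1) M\<close> and \<open>w = d M + f\<close>. In the box \<open>0 \<le> - (T e\<^sub>i + w) < T\<close>, where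
  \<open>0 \<le> w < T\<close>. So all \<open>e\<^sub>i\<close> are 0 if \<open>w = 0\<close>, which gives the zero tuple, and otherwise all are \<open>-1\<close>. The latter is
  \<open>y\<^bsup>q-i\<^esup> z\<^bsup>M-j\<^esup> / \<Prod>k. (x - \<alpha>\<^sub>k)\<close> with \<open>d = q - i\<close> and \<open>f = M - j\<close>, and the excluded index \<open>(q, M)\<close>
  corresponds to \<open>w = 0\<close>.
\<close>

lemma box_profile_cases:
  assumes df: "(d, f) \<in> exps" and u: "has_profile u d f e (\<Sum>i=1..m. e i)"
    and box: "pole_orders u \<in> fundamental_box q M m"
  shows "pole_orders u \<in> S_hat p b q M m \<union> {replicate (m + 1) 0}"
proof -
  define T where "T = int (q + 1) * int M"
  define w where "w = int d * int M + int f"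
  have d: "d \<le> q" "f < M" using df by (auto simp: exps_def)
  have "int d * int M \<le> int q * int M" using d by (intro mult_right_mono) auto
  moreover have "T = int q * int M + int M" by (simp add: T_def algebra_simps)
  ultimately have "w < T" using d(2) unfolding w_def by linarith
  then have w: "0 \<le> w" "w < T" by (simp_all add: w_def)
  have e: "0 \<le> - (T * e i + w) \<and> - (T * e i + w) < T" if i: "i \<in> {1..m}" for i
  proof -
    have "pole_orders u ! i = - (T * e i + w)"
      using u i Qs_nth[OF i] by (simp add: pole_orders_nth has_profile_def T_def w_def)
    moreover have "0 \<le> pole_orders u ! i \<and> pole_orders u ! i < (int q + 1) * int M"
      using box i by (simp add: fundamental_box_def)
    moreover have "T = (int q + 1) * int M" by (simp add: T_def)
    ultimately show ?thesis by simp
  qed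
  have e_val: "e i = (if w = 0 then 0 else -1)" if i: "i \<in> {1..m}" for i
  proof -
    have "T * e i < T * 1" using e[OF i] w by linarith
    then have "e i < 1" using w by (simp only: mult_less_cancel_left_pos)
    moreover have "T * (-2) < T * e i" using e[OF i] w by linarith
    then have "-2 < e i" using w by (simp only: mult_less_cancel_left_pos)
    moreover have "w = 0" if "e i = 0" using e[OF i] w that by simp
    moreover have "w \<noteq> 0" if "e i = -1" using e[OF i] w that by auto
    ultimately show ?thesis by (cases "e i = 0") auto
  qed
  show ?thesis
  proof (cases "w = 0")
    case True
    then have "d = 0" "f = 0" using M_pos by (auto simp: w_def add_nonneg_eq_0_iff)
    then have "pole_orders u = 0 # map (\<lambda>i. 0) [1..<m + 1]"
      unfolding profile_pole_orders[OF u] using e_val True by (auto simp: T_def simp del: upt_Suc)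
    also have "\<dots> = replicate (m + 1) 0" by (simp add: map_replicate_const del: upt_Suc)
    finally show ?thesis by simp
  next
    case False
    have "(\<Sum>i=1..m. e i) = (\<Sum>i=1..m. -1)" using e_val False by (intro sum.cong) auto
    then have E: "(\<Sum>i=1..m. e i) = - int m" by simp
    have "map (\<lambda>i. - (int (q + 1) * int M * e i + int d * int M + int f)) [1..<m + 1]
      = map (\<lambda>i. (int q - int d) * int M + (int M - int f)) [1..<m + 1]"
      using e_val False by (intro map_cong) (auto simp: algebra_simps)
    also have "\<dots> = replicate m ((int q - int d) * int M + (int M - int f))"
      by (simp add: map_replicate_const del: upt_Suc)
    finally have "pole_orders u = alpha_tuple p b q M m (int q - int d) (int M - int f)"
      unfolding profile_pole_orders[OF u] alpha_tuple_eq E by (simp add: algebra_simps power2_eq_square)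
    moreover have "(int q - int d, int M - int f) \<in> index_set q M"
      using d False by (auto simp: index_set_def w_def)
    ultimately show ?thesis by (auto simp: S_hat_def)
  qed
qed

lemma S_hat_absolute_maximal:
  assumes "(i, j) \<in> index_set q M"
  shows "alpha_tuple p b q M m i j \<in> absolute_maximal_elements K Qs \<inter> fundamental_box q M m"
proof -
  have ij: "0 \<le> i" "i \<le> int q" "1 \<le> j" "j \<le> int M" "(i, j) \<noteq> (int q, int M)"
    using assms by (auto simp: index_set_def)
  define d f where "d = nat (int q - i)" and "f = nat (int M - j)"
  have df: "int d = int q - i" "int f = int M - j" using ij by (auto simp: d_def f_def)
  have "d \<le> q" "f < M" using df ij by auto
  then have exps: "(d, f) \<in> exps" by (simp add: exps_def)
  obtain u where u: "has_profile u d f (\<lambda>i. -1) (\<Sum>i=1..m. -1)" using monomial_profile .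
  have "map (\<lambda>k. - (int (q + 1) * int M * (-1) + int d * int M + int f)) [1..<m + 1]
    = replicate m (i * int M + j)"
    by (simp add: map_replicate_const df algebra_simps del: upt_Suc)
  then have eq: "pole_orders u = alpha_tuple p b q M m i j"
    unfolding profile_pole_orders[OF u] alpha_tuple_eq by (simp add: df algebra_simps power2_eq_square)
  have "0 \<le> i * int M + j" using ij by simp
  moreover have "i * int M + j < (int q + 1) * int M"
  proof (cases "i = int q")
    case True
    then show ?thesis using ij by (simp add: algebra_simps)
  next
    case False
    then have "i * int M \<le> (int q - 1) * int M" using ij by (intro mult_right_mono) auto
    then show ?thesis using ij M_pos by (simp add: algebra_simps)
  qed
  ultimately have "alpha_tuple p b q M m i j \<in> fundamental_box q M m"
    unfolding alpha_tuple_eq by (auto simp: fundamental_box_def nth_Cons')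
  with monomial_absolute_maximal[OF exps u] eq show ?thesis by simp
qed

lemma zero_absolute_maximal:
  "replicate (m + 1) 0 \<in> absolute_maximal_elements K Qs \<inter> fundamental_box q M m"
proof -
  obtain u where u: "has_profile u 0 0 (\<lambda>i. 0) (\<Sum>i=1..m. 0)" using monomial_profile .
  have "(0, 0) \<in> exps" using M_pos by (simp add: exps_def)
  from monomial_absolute_maximal[OF this u] have "pole_orders u \<in> absolute_maximal_elements K Qs" .
  moreover have "pole_orders u = replicate (m + 1) 0"
    unfolding profile_pole_orders[OF u] by (simp add: map_replicate_const del: upt_Suc)
  moreover have "0 < (int q + 1) * int M" using M_pos by simp
  ultimately show ?thesis by (auto simp: fundamental_box_def simp del: replicate_Suc)
qed

lemma absolute_maximal_in_box:
  "absolute_maximal_elements K Qs \<inter> fundamental_box q M m = S_hat p b q M m \<union> {replicate (m + 1) 0}"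
proof
  show "absolute_maximal_elements K Qs \<inter> fundamental_box q M m \<subseteq> S_hat p b q M m \<union> {replicate (m + 1) 0}"
  proof
    fix \<gamma> assume \<gamma>: "\<gamma> \<in> absolute_maximal_elements K Qs \<inter> fundamental_box q M m"
    then obtain u d f e where "(d, f) \<in> exps" "has_profile u d f e (\<Sum>i=1..m. e i)" "\<gamma> = pole_orders u"
      using absolute_maximal_monomial[of \<gamma>] by (elim IntE) metis
    with \<gamma> show "\<gamma> \<in> S_hat p b q M m \<union> {replicate (m + 1) 0}"
      using box_profile_cases[of d f u e] by (simp only: Int_iff)
  qed
  show "S_hat p b q M m \<union> {replicate (m + 1) 0} \<subseteq> absolute_maximal_elements K Qs \<inter> fundamental_box q M m"
    using S_hat_absolute_maximal zero_absolute_maximal by (auto simp: S_hat_def)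
qed

end

section \<open>Arithmetic of the parameters\<close>

lemma succ_dvd_odd_power_succ:
  fixes q :: nat
  assumes "odd n"
  shows "q + 1 dvd q ^ n + 1"
proof -
  obtain k where n: "n = 2 * k + 1" using assms by (elim oddE)
  have "int q + 1 dvd int q ^ (2 * k + 1) + 1"
  proof (induction k)
    case (Suc k)
    have "int q ^ (2 * Suc k + 1) + 1
      = int q ^ 2 * (int q ^ (2 * k + 1) + 1) + (int q + 1) * (1 - int q)"
      by (simp add: algebra_simps power2_eq_square)
    moreover have "int q + 1 dvd \<dots>" by (rule dvd_add[OF dvd_mult[OF Suc] dvd_triv_left])
    ultimately show ?case by (simp only:)
  qed simp
  then have "int (q + 1) dvd int (q ^ n + 1)" unfolding n by (simp only: of_nat_add of_nat_1 of_nat_power)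
  then show ?thesis by (simp only: of_nat_dvd_iff)
qed

text \<open>
  Translation by 1 permutes \<open>K\<close>, so summing over \<open>K\<close> shows that the number of
  elements of \<open>K\<close> is zero in the field.
\<close>

lemma char_of_finite_subfield:
  fixes K :: "'f::field set"
  assumes K: "is_subfield K" and p: "prime p" "card K = p ^ k"
  shows "CHAR('f) = p"
proof -
  interpret subfield K by unfold_locales (rule K)
  have "(\<Sum>u\<in>K. u + 1) = (\<Sum>u\<in>K. u)"
    by (rule sum.reindex_bij_witness[of _ "\<lambda>u. u - 1" "\<lambda>u. u + 1"]) (auto intro: K_closed K_diff)
  then have "of_nat (card K) = (0 :: 'f)" by (simp add: sum.distrib)
  then have "of_nat p = (0 :: 'f)" by (simp add: p(2))
  then have "CHAR('f) dvd p" by (simp add: of_nat_eq_0_iff_char_dvd)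
  then show ?thesis using p(1) CHAR_not_1[where 'a = 'f] by (auto simp: prime_nat_iff)
qed

theorem theorem3p3:
  fixes p a b n s q M m :: nat
    and K :: "'f::field set"
    and c x y z :: 'f
    and \<alpha> :: "nat \<Rightarrow> 'f"
    and Pinf :: "'f \<Rightarrow> int"
    and P :: "nat \<Rightarrow> 'f \<Rightarrow> int"
  assumes "prime p" and "a \<ge> 1" and "b \<ge> 1" and "n \<ge> 1" and "s \<ge> 1"
    and "q = p ^ a"
    and "odd n" and "b dvd a" and "s dvd (q ^ n + 1) div (q + 1)"
    and "M = (q ^ n + 1) div (s * (q + 1))"
    and "curve_function_field p a b n s c K x y z"
    and "c \<in> K" and "c ^ (q ^ 2) = c" and "c ^ (q - 1) = -1"
    and "rational_place K Pinf" and "Pinf x < 0" and "Pinf y < 0" and "Pinf z < 0"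
    and "bij_betw \<alpha> {1..q div p ^ b} {u \<in> K. tpoly p a b u = 0}"
    and "\<And>i. i \<in> {1..q div p ^ b} \<Longrightarrow>
           rational_place K (P i) \<and> vanishes_at (P i) (x - \<alpha> i) \<and>
           vanishes_at (P i) y \<and> vanishes_at (P i) z"
    and "1 \<le> m" and "m \<le> q div p ^ b"
  shows "absolute_maximal_elements K (Pinf # map P [1..<m + 1]) \<inter> fundamental_box q M m
           = S_hat p b q M m \<union> {replicate (m + 1) 0}"
proof -
  define r where "r = p ^ (a - b)"
  have K: "is_subfield K" "card K = q ^ (2 * n)"
    and gen: "\<And>L. is_subfield L \<Longrightarrow> K \<subseteq> L \<Longrightarrow> {x, y, z} \<subseteq> L \<Longrightarrow> L = UNIV"
    and x: "\<not> algebraic_over K x" and eq_xy: "c * y ^ (q + 1) = tpoly p a b x"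
    and eq_yz: "y ^ (q ^ 2) - y = z ^ M"
    using assms(11) unfolding curve_function_field_def Let_def assms(6)[symmetric] assms(10)[symmetric]
    by blast+
  have q: "q > 1" using prime_gt_1_nat[OF assms(1)] assms(2,6) by (simp add: one_less_power del: One_nat_def)
  have Pinf: "is_place K Pinf" using assms(15) by (simp add: rational_place_def)
  have Pinf0: "Pinf 0 = 0" using Pinf by (simp add: is_place_def)
  obtain t where t: "q ^ n + 1 = (q + 1) * (s * t)"
    using succ_dvd_odd_power_succ[OF assms(7), of q] assms(9) by (metis dvd_mult_div_cancel dvdE)
  have "q ^ n + 1 = s * (q + 1) * t" using t by (simp only: mult_ac)
  moreover have "s * (q + 1) > 0" using assms(5) by simp
  ultimately have "M = t" unfolding assms(10) by (metis nonzero_mult_div_cancel_left less_not_refl)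
  with t have M: "M > 0" "M dvd q ^ n + 1" by (auto intro: gr0I)
  have "coprime (q ^ n + 1) (q ^ n)" by (rule coprime_add_one_left)
  moreover have "q ^ n = p ^ (a * n)" by (simp add: assms(6) power_mult)
  ultimately have "coprime (q ^ n + 1) (p ^ (a * n))" by metis
  moreover have "a * n > 0" using assms(2,4) by simp
  ultimately have "coprime (q ^ n + 1) p" by (simp only: coprime_power_right_iff) auto
  then have coprime: "coprime M p" using coprime_divisors[OF M(2) dvd_refl] by blast
  have card: "card K = p ^ (a * (2 * n))" using K(2) assms(6) by (simp add: power_mult)
  have "b \<le> a" using assms(2,8) by (intro dvd_imp_le) auto
  then have "q = p ^ b * r" by (simp add: assms(6) r_def flip: power_add)
  then have r: "q div p ^ b = r" using assms(1) by (simp add: prime_gt_0_nat)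
  have \<alpha>: "\<alpha> i \<in> K" "tpoly p a b (\<alpha> i) = 0" if "i \<in> {1..m}" for i
    using assms(19,22) that by (auto simp: bij_betw_def)
  have point: "is_place K (P i)" "0 < P i (x - \<alpha> i)" if i: "i \<in> {1..m}" for i
  proof -
    have i': "i \<in> {1..q div p ^ b}" using i assms(22) by auto
    show "is_place K (P i)" using assms(20)[OF i'] by (simp add: rational_place_def)
    have "Pinf (\<alpha> i) = 0" using Pinf \<alpha>(1)[OF i] by (simp add: is_place_def)
    then have "x - \<alpha> i \<noteq> 0" using assms(16) by auto
    then show "0 < P i (x - \<alpha> i)" using assms(20)[OF i'] by (simp add: vanishes_at_def)
  qed
  interpret pointed_curve K p a b q r M c x y z Pinf m \<alpha> P
  proof unfold_locales
    show "finite K" using K(2) q by (intro card_ge_0_finite) simp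
    show "CHAR('f) = p" by (rule char_of_finite_subfield[OF K(1) assms(1) card])
    show "c \<noteq> 0" using assms(14) q by (auto simp: power_0_left)
    show "y \<noteq> 0" "z \<noteq> 0" using assms(17,18) Pinf0 by auto
    show "inj_on \<alpha> {1..m}" using assms(19,22) by (auto simp: bij_betw_def intro: inj_on_subset)
    show "L = UNIV" if "is_subfield L" "K \<subseteq> L" "{x, y, z} \<subseteq> L" for L using gen that by blast
  qed (use K x eq_xy eq_yz M coprime \<alpha> point r_def assms in auto)
  show ?thesis using absolute_maximal_in_box by (simp only: Qs_def)
qed

end
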